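(* Let $\lambda$ be a partition, let $q$ be a critical degree of $\overset{*}{\mathcal R}{}^{(\lambda)}$, let $\sigma_q=\sigma^{(\lambda)}_q(x,y)\in\overset{*}{\mathcal R}{}^{(\lambda)}$ be weighted-homogeneous (with $\deg x=1,\deg y=2$), monic in $x$ and of degree $q$, let $\pi_q=\sigma_q^\sharp$, and let $\Theta^{(\lambda)}_q=\Theta^{(\lambda)}_{\pi_q}$ be the corresponding difference operator, so that by definition $$\sigma_q(x,y)\,R^{(\lambda)}_m(x,y)=\Theta^{(\lambda)}_q(m,y,\mathsf S_m)\,R^{(\lambda)}_m(x,y),\qquad m\in\mathcal J^{(\lambda)}.$$ Then $\deg_y\pi_q(x,y,z)\le q$ and $$\Theta^{(\lambda)}_q(m,y,z)=(-2y)^q\,\pi^\natural_q\big(m,(4y)^{-1},z\big).$$ Explicitly, for $m\in\mathcal J^{(\lambda)}$, $$\sigma_q(x,y)R^{(\lambda)}_m(x,y)=y^{q/2}\sum_{k}(-2)^{-k}\,\pi^\natural_{q,-k}(m)\,y^{-k/2}\,R^{(\lambda)}_{m+k}(x,y),$$ where $k$ runs over $-q,-q+2,\dots,q$ (terms with $m+k\notin\mathcal J^{(\lambda)}$ have zero coefficient and are omitted).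
   Context: Partitions: $\lambda_1\ge\lambda_2\ge\cdots\ge0$ integers, $N=|\lambda|=\sum\lambda_i<\infty$, $\ell$ the number of nonzero entries, $m_i=\lambda_i-i$ ($i\ge1$), $\mathcal M^{(\lambda)}=\{m_i:i\ge1\}$, $\mathcal J^{(\lambda)}=\mathbb Z\setminus\mathcal M^{(\lambda)}$, $k_i=m_i+\ell$ for $1\le i\le\ell$. For $k\in\mathbb Z$: $\mathcal G^{(\lambda)}_k=(\mathcal M^{(\lambda)}+k)\cap\mathcal J^{(\lambda)}$, $\gamma^{(\lambda)}_k(m)=\prod_{i\in\mathcal G^{(\lambda)}_k}(m-i)$. Bivariate Hermite polynomials: $e^{xz+yz^2}=\sum_{n\ge0}H_n(x,y)z^n/n!$. With $\mathrm{Wr}$ the Wronskian in $x$, $$R^{(\lambda)}_m=\frac{1}{\prod_{i=1}^{\ell}(m-m_i)}\,\frac{\mathrm{Wr}[H_{k_\ell},\dots,H_{k_1},H_{m+\ell}]}{\mathrm{Wr}[H_{k_\ell},\dots,H_{k_1}]}\ (m\in\mathcal J^{(\lambda)}),\qquad \Psi^{(\lambda)}(x,y,z)=\frac{\mathrm{Wr}[H_{k_\ell},\dots,H_{k_1},e^{xz+yz^2}]}{z^\ell\,\mathrm{Wr}[H_{k_\ell},\dots,H_{k_1}]}.$$ $W^{(\lambda)}=\mathrm{span}\{z^m:m\in\mathcal J^{(\lambda)}\}$; $\overset{*}{W}{}^{(\lambda)}$ is the $\mathbb C[y]$-span of the $R^{(\lambda)}_m(x,y)$. When a derivative is substituted for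 a variable, derivatives are placed to the right of the other variables. $\mathcal A^{(\lambda)}$ is the algebra of differential operators $\pi(\partial_z,z)$, $\pi(x,z)\in\mathbb C[x,z,z^{-1}]$, preserving $W^{(\lambda)}$. $\overset{*}{\mathcal R}{}^{(\lambda)}$ is the ring of polynomials $\sigma(x,y)\in\mathbb C[x,y]$ with $\sigma\overset{*}{W}{}^{(\lambda)}\subset\overset{*}{W}{}^{(\lambda)}$; $q\ge0$ is a critical degree of it if some $\sigma\in\overset{*}{\mathcal R}{}^{(\lambda)}$ has $\deg_x\sigma=q$. For $\sigma\in\overset{*}{\mathcal R}{}^{(\lambda)}$, $\sigma^\sharp(\partial_z,y,z)$ is the unique element of $\mathcal A^{(\lambda)}\otimes\mathbb C[y]$ such that $\sigma^\sharp(\partial_z,y,z)\Psi^{(\lambda)}=\sigma(x,y)\Psi^{(\lambda)}$. Give $\mathbb C[x,y,z,z^{-1}]$ the grading $\deg x=1,\deg y=2,\deg z=-1$; $\pi_q=\pi_q(x,y,z)$ is weighted-homogeneous of degree $q$. For $\pi\in\mathbb C[x,y,z,z^{-1}]$ let $\pi^\natural(m,y,z)\in\mathbb C[m,y,z,z^{-1}]$ be defined by $\pi(\partial_z,y,z)z^m=\pi^\natural(m,y,z)z^m$. For $\pi=\pi_q$ write, with $d=\deg_y\pi_q$, $$\pi_q^\natural(m,y,z)=\sum_{j=0}^d\pi^\natural_{q,q-2j}(m)\,y^jz^{2j-q}=y^{q/2}\sum_k\pi^\natural_{q,k}(m)\,y^{-k/2}z^{-k},\quad k=q-2j .$$ Each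 $\pi^\natural_{q,k}(m)$ is divisible by $\gamma^{(\lambda)}_k(m)$; put $\alpha_{q,k}=\pi^\natural_{q,k}/\gamma^{(\lambda)}_k$ and $$\Theta^{(\lambda)}_{\pi_q}(m,y,\mathsf S_m)=y^{q/2}\sum_k\gamma^{(\lambda)}_{-k}(m)\,\alpha_{q,k}(m+k)\,y^{-k/2}\,\mathsf S_m^k,$$ where $\mathsf S_m$ is the unit shift in $m$; $\Theta^{(\lambda)}_q(m,y,z)$ denotes the same expression with $\mathsf S_m$ replaced by the variable $z$. *)

theory Defs
  imports
    "HOL-Computational_Algebra.Computational_Algebra"
    "HOL-Library.Poly_Mapping"
    "Jordan_Normal_Form.Determinant"
begin

text \<open>
  Representation of the rings involved:
  \<^item> \<open>complex poly poly\<close> is $\mathbb{C}[x,y]$ (or $\mathbb{C}[m,y]$): the outer variable is $x$ (or $m$),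
    the inner variable is $y$.
  \<^item> \<open>int \<Rightarrow>\<^sub>0 'a poly\<close> is the space of Laurent polynomials in $z$ with coefficients in \<open>'a[x]\<close>:
    \<open>lookup \<pi> k\<close> is the coefficient of $z^k$. So \<open>int \<Rightarrow>\<^sub>0 complex poly\<close> is $\mathbb{C}[x,z,z^{-1}]$
    and \<open>int \<Rightarrow>\<^sub>0 complex poly poly\<close> is $\mathbb{C}[x,y,z,z^{-1}]$.
  \<^item> \<open>complex poly poly fract\<close> is the field $\mathbb{C}(x,y)$, and \<open>fls\<close> are Laurent series in $z$.
\<close>

section \<open>Partitions\<close>

text \<open>A partition is indexed from \<open>1\<close>; the value at \<open>0\<close> is irrelevant.\<close>

definition is_partition :: "(nat \<Rightarrow> nat) \<Rightarrow> bool" where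
  "is_partition lam \<longleftrightarrow> (\<forall>i\<ge>1. lam (Suc i) \<le> lam i) \<and> finite {i. 1 \<le> i \<and> lam i \<noteq> 0}"

definition plen :: "(nat \<Rightarrow> nat) \<Rightarrow> nat" where
  "plen lam = card {i. 1 \<le> i \<and> lam i \<noteq> 0}"

definition mpart :: "(nat \<Rightarrow> nat) \<Rightarrow> nat \<Rightarrow> int" where
  "mpart lam i = int (lam i) - int i"

definition Mset :: "(nat \<Rightarrow> nat) \<Rightarrow> int set" where
  "Mset lam = mpart lam ` {1..}"

definition Jset :: "(nat \<Rightarrow> nat) \<Rightarrow> int set" where
  "Jset lam = UNIV - Mset lam"

text \<open>For a partition and \<open>1 \<le> i \<le> plen lam\<close> the integer under \<open>nat\<close> is positive.\<close>

definition kpart :: "(nat \<Rightarrow> nat) \<Rightarrow> nat \<Rightarrow> nat" where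
  "kpart lam i = nat (mpart lam i + int (plen lam))"

definition Gset :: "(nat \<Rightarrow> nat) \<Rightarrow> int \<Rightarrow> int set" where
  "Gset lam k = (\<lambda>a. a + k) ` Mset lam \<inter> Jset lam"

definition gam :: "(nat \<Rightarrow> nat) \<Rightarrow> int \<Rightarrow> complex poly" where
  "gam lam k = (\<Prod>i\<in>Gset lam k. [:- of_int i, 1:])"

section \<open>Hermite polynomials and Wronskians\<close>

definition varx :: "complex poly poly" where "varx = [:0, 1:]"

definition vary :: "complex poly poly" where "vary = [:[:0, 1:]:]"

text \<open>The series $e^{xz+yz^2}$, as the composition of $e^u$ with $u = xz+yz^2$.\<close>

definition exp_xyz :: "complex poly poly fps" where
  "exp_xyz = fps_compose (Abs_fps (\<lambda>n. [:[:1 / fact n:]:]))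
     (fps_const varx * fps_X + fps_const vary * fps_X ^ 2)"

definition hermite :: "nat \<Rightarrow> complex poly poly" where
  "hermite n = fact n * fps_nth exp_xyz n"

definition wronskian :: "('a::comm_ring_1 \<Rightarrow> 'a) \<Rightarrow> 'a list \<Rightarrow> 'a" where
  "wronskian D fs = det (mat (length fs) (length fs) (\<lambda>(i, j). (D ^^ i) (fs ! j)))"

definition fps_dx :: "complex poly poly fps \<Rightarrow> complex poly poly fps" where
  "fps_dx F = Abs_fps (\<lambda>n. pderiv (fps_nth F n))"

text \<open>The list $H_{k_\ell},\dots,H_{k_1}$.\<close>

definition hermites :: "(nat \<Rightarrow> nat) \<Rightarrow> complex poly poly list" where
  "hermites lam = map (\<lambda>i. hermite (kpart lam i)) (rev [1..<Suc (plen lam)])"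

text \<open>\<open>exc_hermite lam m\<close> is $R^{(\lambda)}_m$; it is only meaningful for \<open>m \<in> Jset lam\<close>, where
  $m+\ell \ge 0$ and the product does not vanish.\<close>

definition exc_hermite :: "(nat \<Rightarrow> nat) \<Rightarrow> int \<Rightarrow> complex poly poly fract" where
  "exc_hermite lam m =
     to_fract [:[:1 / (\<Prod>i=1..plen lam. of_int (m - mpart lam i)):]:] *
     Fract (wronskian pderiv (hermites lam @ [hermite (nat (m + int (plen lam)))]))
           (wronskian pderiv (hermites lam))"

definition Psi :: "(nat \<Rightarrow> nat) \<Rightarrow> complex poly poly fract fls" where
  "Psi lam = fls_X_intpow (- int (plen lam)) *
     fps_to_fls (Abs_fps (\<lambda>n.
       Fract (fps_nth (wronskian fps_dx (map fps_const (hermites lam) @ [exp_xyz])) n)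
             (wronskian pderiv (hermites lam))))"

section \<open>Differential operators in \<open>z\<close>\<close>

text \<open>\<open>diffop_apply c \<pi> f\<close> is $\pi(\partial_z,z)f = \sum_{k,i} \pi_{k,i} z^k \partial_z^i f$,
  where \<open>c\<close> is the map from the coefficient ring of \<open>\<pi>\<close> to that of \<open>f\<close>.\<close>

definition diffop_apply ::
    "('a::comm_ring_1 \<Rightarrow> 'b::comm_ring_1) \<Rightarrow> (int \<Rightarrow>\<^sub>0 'a poly) \<Rightarrow> 'b fls \<Rightarrow> 'b fls" where
  "diffop_apply c \<pi> f =
     (\<Sum>k\<in>Poly_Mapping.keys \<pi>. \<Sum>i\<le>degree (Poly_Mapping.lookup \<pi> k).
        fls_const (c (coeff (Poly_Mapping.lookup \<pi> k) i)) * fls_X_intpow k * (fls_deriv ^^ i) f)"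

definition Wspace :: "(nat \<Rightarrow> nat) \<Rightarrow> complex fls set" where
  "Wspace lam = Modules.module.span (\<lambda>c f. fls_const c * f) (fls_X_intpow ` Jset lam)"

definition Aalg :: "(nat \<Rightarrow> nat) \<Rightarrow> (int \<Rightarrow>\<^sub>0 complex poly) set" where
  "Aalg lam = {\<pi>. \<forall>w\<in>Wspace lam. diffop_apply (\<lambda>c. c) \<pi> w \<in> Wspace lam}"

definition ycoeff :: "nat \<Rightarrow> (int \<Rightarrow>\<^sub>0 complex poly poly) \<Rightarrow> (int \<Rightarrow>\<^sub>0 complex poly)" where
  "ycoeff j \<pi> = Poly_Mapping.map (map_poly (\<lambda>p. coeff p j)) \<pi>"

text \<open>The elements $\sum_j \pi_j y^j$ of $\mathcal{A}\otimes\mathbb{C}[y]$, $\pi_j\in\mathcal{A}$.\<close>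

definition Aalg_y :: "(nat \<Rightarrow> nat) \<Rightarrow> (int \<Rightarrow>\<^sub>0 complex poly poly) set" where
  "Aalg_y lam = {\<pi>. \<forall>j. ycoeff j \<pi> \<in> Aalg lam}"

definition degy :: "(int \<Rightarrow>\<^sub>0 complex poly poly) \<Rightarrow> nat" where
  "degy \<pi> = Max (insert 0 {j. \<exists>k i. coeff (coeff (Poly_Mapping.lookup \<pi> k) i) j \<noteq> 0})"

text \<open>The $\mathbb{C}[y]$-span of the $R^{(\lambda)}_m$, $m\in\mathcal{J}^{(\lambda)}$.\<close>

definition Wstar :: "(nat \<Rightarrow> nat) \<Rightarrow> complex poly poly fract set" where
  "Wstar lam = Modules.module.span (\<lambda>c f. to_fract [:c:] * f) (exc_hermite lam ` Jset lam)"

definition Rstar :: "(nat \<Rightarrow> nat) \<Rightarrow> complex poly poly set" where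
  "Rstar lam = {\<sigma>. \<forall>w\<in>Wstar lam. to_fract \<sigma> * w \<in> Wstar lam}"

definition critical_degree :: "(nat \<Rightarrow> nat) \<Rightarrow> nat \<Rightarrow> bool" where
  "critical_degree lam q \<longleftrightarrow> (\<exists>\<sigma>\<in>Rstar lam. \<sigma> \<noteq> 0 \<and> degree \<sigma> = q)"

definition weighted_homogeneous :: "nat \<Rightarrow> complex poly poly \<Rightarrow> bool" where
  "weighted_homogeneous q \<sigma> \<longleftrightarrow> (\<forall>i j. coeff (coeff \<sigma> i) j \<noteq> 0 \<longrightarrow> i + 2 * j = q)"

text \<open>\<open>is_sharp lam \<sigma> \<pi>\<close>: \<open>\<pi>\<close> is the element $\sigma^\sharp$ of $\mathcal{A}\otimes\mathbb{C}[y]$.\<close>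

definition is_sharp ::
    "(nat \<Rightarrow> nat) \<Rightarrow> complex poly poly \<Rightarrow> (int \<Rightarrow>\<^sub>0 complex poly poly) \<Rightarrow> bool" where
  "is_sharp lam \<sigma> \<pi> \<longleftrightarrow> \<pi> \<in> Aalg_y lam \<and>
     diffop_apply (\<lambda>c. to_fract [:c:]) \<pi> (Psi lam) = fls_const (to_fract \<sigma>) * Psi lam"

section \<open>The symbol $\pi^\natural$ and the difference operator\<close>

text \<open>$m(m-1)\cdots(m-i+1)$ as a polynomial in $m$.\<close>

definition ffact_poly :: "nat \<Rightarrow> 'a::comm_ring_1 poly" where
  "ffact_poly i = (\<Prod>j<i. [:- of_nat j, 1:])"

text \<open>\<open>natural \<pi>\<close> is $\pi^\natural$, a Laurent polynomial in $z$ with coefficients in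
  $\mathbb{C}[m,y]$; its defining property is the lemma \<open>natural_iff\<close> below.\<close>

definition natural :: "(int \<Rightarrow>\<^sub>0 complex poly poly) \<Rightarrow> (int \<Rightarrow>\<^sub>0 complex poly poly)" where
  "natural \<pi> =
     (\<Sum>k\<in>Poly_Mapping.keys \<pi>. \<Sum>i\<le>degree (Poly_Mapping.lookup \<pi> k).
        Poly_Mapping.single (k - int i)
          (Polynomial.smult (coeff (Poly_Mapping.lookup \<pi> k) i) (ffact_poly i)))"

text \<open>$P(m,y,z)$ as a Laurent polynomial in $z$ over $\mathbb{C}[y]$, for an integer $m$.\<close>

definition at_int :: "(int \<Rightarrow>\<^sub>0 complex poly poly) \<Rightarrow> int \<Rightarrow> complex poly fls" where
  "at_int P m = (\<Sum>k\<in>Poly_Mapping.keys P.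
     fls_const (poly (Poly_Mapping.lookup P k) (of_int m)) * fls_X_intpow k)"

lemma fls_nth_const_intpow_mult:
  "fls_nth (fls_const c * fls_X_intpow k * f) n = c * fls_nth (f :: 'a::comm_ring_1 fls) (n - k)"
  by (subst mult.assoc, subst fls_X_intpow_times_conv_shift(1)) simp

lemma fls_nth_higher_deriv_X_intpow:
  "fls_nth ((fls_deriv ^^ i) (fls_X_intpow m :: 'a::comm_ring_1 fls)) n =
     (if n = m - int i then poly (ffact_poly i) (of_int m) else 0)"
proof (induction i arbitrary: n)
  case 0
  then show ?case by (simp add: ffact_poly_def)
next
  case (Suc i)
  have "poly (ffact_poly (Suc i)) (of_int m) =
      (of_int m - of_nat i) * poly (ffact_poly i) (of_int m :: 'a)"
    by (simp add: ffact_poly_def algebra_simps)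
  then show ?case using Suc by simp
qed

lemma fls_nth_sum: "fls_nth (\<Sum>i\<in>A. f i) n = (\<Sum>i\<in>A. fls_nth (f i) n)"
  by (induction A rule: infinite_finite_induct) auto

lemma lookup_sum_apply:
  "Poly_Mapping.lookup (\<Sum>i\<in>A. f i) n = (\<Sum>i\<in>A. Poly_Mapping.lookup (f i) n)"
  by (induction A rule: infinite_finite_induct) (auto simp: lookup_add)

lemma fls_nth_at_int: "fls_nth (at_int P m) n = poly (Poly_Mapping.lookup P n) (of_int m)"
proof -
  have "fls_nth (at_int P m) n =
      (\<Sum>k\<in>Poly_Mapping.keys P. if k = n then poly (Poly_Mapping.lookup P k) (of_int m) else 0)"
    unfolding at_int_def fls_nth_sum
    by (intro sum.cong) (auto simp: fls_X_intpow_times_conv_shift)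
  then show ?thesis by (auto simp: sum.delta in_keys_iff)
qed

lemma diffop_apply_X_intpow:
  "diffop_apply (\<lambda>c. c) \<pi> (fls_X_intpow m) = at_int (natural \<pi>) m * fls_X_intpow m"
proof (rule fls_eqI)
  fix n
  have "fls_nth (at_int (natural \<pi>) m * fls_X_intpow m) n =
      poly (Poly_Mapping.lookup (natural \<pi>) (n - m)) (of_int m)"
    by (simp add: fls_X_intpow_times_conv_shift fls_nth_at_int)
  also have "\<dots> = fls_nth (diffop_apply (\<lambda>c. c) \<pi> (fls_X_intpow m)) n"
    unfolding natural_def diffop_apply_def lookup_sum_apply fls_nth_sum poly_sum
      fls_nth_const_intpow_mult fls_nth_higher_deriv_X_intpow
    by (intro sum.cong) (auto simp: lookup_single when_def)
  finally show "fls_nth (diffop_apply (\<lambda>c. c) \<pi> (fls_X_intpow m)) n =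
      fls_nth (at_int (natural \<pi>) m * fls_X_intpow m) n" ..
qed

lemma natural_iff:
  "(\<forall>m. diffop_apply (\<lambda>c. c) \<pi> (fls_X_intpow m) = at_int P m * fls_X_intpow m) \<longleftrightarrow> P = natural \<pi>"
proof
  assume *: "\<forall>m. diffop_apply (\<lambda>c. c) \<pi> (fls_X_intpow m) = at_int P m * fls_X_intpow m"
  show "P = natural \<pi>"
  proof (rule poly_mapping_eqI)
    fix n
    have "at_int P m = at_int (natural \<pi>) m" for m
      using *[rule_format, of m] unfolding diffop_apply_X_intpow fls_X_intpow_times_conv_shift
      by (metis fls_shift_eq_iff)
    then have "poly (Poly_Mapping.lookup P n - Poly_Mapping.lookup (natural \<pi>) n) (of_int m) = 0"
      for m by (simp flip: fls_nth_at_int)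
    then have "range of_int \<subseteq>
        {a. poly (Poly_Mapping.lookup P n - Poly_Mapping.lookup (natural \<pi>) n) a = 0}"
      by auto
    moreover have "infinite (range (of_int :: int \<Rightarrow> complex poly))"
      by (auto dest!: finite_imageD intro: injI)
    ultimately show "Poly_Mapping.lookup P n = Poly_Mapping.lookup (natural \<pi>) n"
      by (metis eq_iff_diff_eq_0 infinite_super poly_roots_finite)
  qed
qed (simp add: diffop_apply_X_intpow)

text \<open>$\pi^\natural_{q,k}(m)$: for $k = q-2j$ with $j \ge 0$, the coefficient of $y^j z^{-k}$
  in $\pi^\natural$.\<close>

definition nat_coeff :: "nat \<Rightarrow> (int \<Rightarrow>\<^sub>0 complex poly poly) \<Rightarrow> int \<Rightarrow> complex poly" where
  "nat_coeff q \<pi> k =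
     (if k \<le> int q \<and> even (int q - k)
      then map_poly (\<lambda>p. coeff p (nat ((int q - k) div 2))) (Poly_Mapping.lookup (natural \<pi>) (- k))
      else 0)"

definition alpha ::
    "(nat \<Rightarrow> nat) \<Rightarrow> nat \<Rightarrow> (int \<Rightarrow>\<^sub>0 complex poly poly) \<Rightarrow> int \<Rightarrow> complex poly" where
  "alpha lam q \<pi> k = nat_coeff q \<pi> k div gam lam k"

text \<open>\<open>Theta lam q \<pi>\<close> is $\Theta_\pi(m,y,z)$: the sum is over $k = q-2j$, $0\le j\le\deg_y\pi$, so that
  $y^{q/2}y^{-k/2} = y^j$.\<close>

definition Theta ::
    "(nat \<Rightarrow> nat) \<Rightarrow> nat \<Rightarrow> (int \<Rightarrow>\<^sub>0 complex poly poly) \<Rightarrow> (int \<Rightarrow>\<^sub>0 complex poly poly)" where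
  "Theta lam q \<pi> =
     (\<Sum>j\<le>degy \<pi>. let k = int q - 2 * int j in
        Poly_Mapping.single k
          (Polynomial.smult (Polynomial.monom 1 j)
             (map_poly (\<lambda>c. [:c:]) (gam lam (- k) * pcompose (alpha lam q \<pi> k) [:of_int k, 1:]))))"

text \<open>The value $P(m,y,z)$ at complex numbers, $z \ne 0$.\<close>

definition eval3 :: "(int \<Rightarrow>\<^sub>0 complex poly poly) \<Rightarrow> complex \<Rightarrow> complex \<Rightarrow> complex \<Rightarrow> complex" where
  "eval3 P m y z =
     (\<Sum>k\<in>Poly_Mapping.keys P. poly (poly (Poly_Mapping.lookup P k) [:m:]) y * z powi k)"

end

theory Submission
  imports Defs "HOL-Computational_Algebra.Field_as_Ring"
begin

text \<open>
  The exceptional polynomials are the images of the Hermite polynomials under an iterated Darboux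
  transformation $A$, whose adjoint $B$ for the weight $e^{x^2/4y}$ satisfies
  $BA\,H_n = \prod_i (k_i - n)\,H_n$. Hence the $R_m$ are formally orthogonal with known norms, and
  multiplication by $\sigma$, being symmetric for this form, has matrix entries symmetric up to the
  ratio of the norms. The entries are read off from $\pi^\natural$ by expanding
  $\Psi = \sum_m c_m R_m z^m$, so the symmetry relates $\pi^\natural_{q,k}(m+k)$ to
  $\pi^\natural_{q,-k}(m)$, and the ratio $c_{m+k}/c_m$ is
  $\gamma_{-k}(m)/\gamma_k(m+k)$. The integral is replaced by a functional on polynomials that
  kills total derivatives; it applies to rational functions because a rational $h$ for which
  $2y\,h' + xh$ is a polynomial has no poles in $x$.
\<close>

section \<open>Iterated Darboux transformations\<close>

text \<open>The product of \<sigma>, R_m and R_n is rational, so the functional cannot be applied to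
  it. The adjoint B sends R_m to +-H_(m+l) and therefore, by the recurrence, sends \<sigma> R_m to a
  polynomial. The rational product occurs in the adjunction identity for (m,n) and in the one for
  (n,m), and cancels in their difference; only the polynomial that remains is integrated. The
  constants come from the norm (-2y)^n n! of H_n: the factorials are absorbed into c_m, leaving
  (-2)^(-k). Since powers of y are nonnegative, only k <= q occurs; the symmetry between k and -k
  then forces k >= -q, which is the bound on the y-degree. Substituting 1/(4y) for y realises the
  reflection of the exponent j of y into q-j. Homogeneity of \<pi> is derived: it passes from
  \<sigma> to the coefficients of the recurrence because the R_m are independent over C[y]. Since J
  contains every large integer, identities between polynomials in m are checked at large m
  only.\<close>

locale derivation =
  fixes D :: "'a::field \<Rightarrow> 'a"
  assumes D_add: "D (a + b) = D a + D b"
    and D_mult: "D (a * b) = D a * b + a * D b"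
begin

lemma D_0 [simp]: "D 0 = 0"
  by (metis D_add add_cancel_right_right)

lemma D_uminus: "D (- a) = - D a"
  using D_add[of a "- a"] by (simp add: eq_neg_iff_add_eq_0 add.commute)

lemma D_diff: "D (a - b) = D a - D b"
  using D_add[of a "- b"] by (simp add: D_uminus)

lemma D_1 [simp]: "D 1 = 0"
  by (metis D_mult add_cancel_right_right mult_1 mult_1_right)

lemma D_of_nat [simp]: "D (of_nat n) = 0"
  by (induction n) (auto simp: D_add)

lemma D_numeral [simp]: "D (numeral n) = 0"
  using D_of_nat[of "numeral n"] by simp

lemma D_sum: "D (\<Sum>i\<in>S. f i) = (\<Sum>i\<in>S. D (f i))"
  by (induction S rule: infinite_finite_induct) (auto simp: D_add)

lemma D_power_const: "D a = 0 \<Longrightarrow> D (a ^ n) = 0"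
  by (induction n) (auto simp: D_mult)

lemma D_funpow_linear: "D a = 0 \<Longrightarrow> (D ^^ j) (a * f + g) = a * (D ^^ j) f + (D ^^ j) g"
  by (induction j) (auto simp: D_add D_mult)

definition monic_op :: "nat \<Rightarrow> ('a \<Rightarrow> 'a) \<Rightarrow> bool" where
  "monic_op n A \<longleftrightarrow> (\<exists>c. \<forall>f. A f = (\<Sum>j<n. c j * (D ^^ j) f) + (D ^^ n) f)"

lemma monic_op_linear:
  assumes "monic_op n A" "D a = 0"
  shows "A (a * f + g) = a * A f + A g"
proof -
  from assms(1) obtain c where c: "\<And>f. A f = (\<Sum>j<n. c j * (D ^^ j) f) + (D ^^ n) f"
    unfolding monic_op_def by blast
  show ?thesis unfolding c D_funpow_linear[OF assms(2)]
    by (simp add: sum_distrib_left sum.distrib algebra_simps)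
qed

text \<open>Composition with a first-order factor \<open>D - u\<close>, the algebraic content of one
  Darboux step.\<close>

lemma monic_op_Suc:
  assumes "monic_op n A"
  shows "monic_op (Suc n) (\<lambda>f. D (A f) - u * A f)"
proof -
  from assms(1) obtain c where c: "\<And>f. A f = (\<Sum>j<n. c j * (D ^^ j) f) + (D ^^ n) f"
    unfolding monic_op_def by blast
  \<comment> \<open>\<open>c0\<close> includes the leading coefficient 1, so that D acts on one
    uniform sum.\<close>
  define c0 where "c0 j = (if j < n then c j else 1)" for j
  have c0: "A f = (\<Sum>j<Suc n. c0 j * (D ^^ j) f)" for f
    by (simp add: c c0_def)
  define c' where "c' j = D (c0 j) - u * c0 j + (if j = 0 then 0 else c0 (j - 1))" for j
  have "D (A f) - u * A f = (\<Sum>j<Suc n. c' j * (D ^^ j) f) + (D ^^ Suc n) f" for f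
  proof -
    have "D (A f) - u * A f =
        (\<Sum>j<Suc n. (D (c0 j) - u * c0 j) * (D ^^ j) f) + (\<Sum>j<Suc n. c0 j * (D ^^ Suc j) f)"
      unfolding c0 D_sum by (simp add: D_mult sum_distrib_left sum.distrib sum_subtractf algebra_simps)
    also have "(\<Sum>j<Suc n. c0 j * (D ^^ Suc j) f) = (\<Sum>j<n. c0 j * (D ^^ Suc j) f) + (D ^^ Suc n) f"
      by (simp add: c0_def)
    also have "(\<Sum>j<n. c0 j * (D ^^ Suc j) f) =
        (\<Sum>j<Suc n. (if j = 0 then 0 else c0 (j - 1)) * (D ^^ j) f)"
      by (subst sum.lessThan_Suc_shift) simp
    finally show ?thesis
      by (simp only: c'_def distrib_right sum.distrib add.assoc)
  qed
  then show ?thesis unfolding monic_op_def by blast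
qed

text \<open>Replacing the last row of the Wronskian matrix by its combination with the coefficients
  of \<open>A\<close> is a unipotent row operation, and the kernel condition leaves
  \<open>A f\<close> as the only nonzero entry there. Thus \<open>A\<close> is the quotient of
  Wronskians in Crum's formula.\<close>

lemma wronskian_append:
  assumes "monic_op (length fs) A" and "\<And>g. g \<in> set fs \<Longrightarrow> A g = 0"
  shows "wronskian D (fs @ [f]) = wronskian D fs * A f"
proof -
  from assms(1) obtain c where
    c: "\<And>f. A f = (\<Sum>j<length fs. c j * (D ^^ j) f) + (D ^^ length fs) f"
    unfolding monic_op_def by blast
  define n where "n = length fs"
  define M where "M = mat (Suc n) (Suc n) (\<lambda>(i, j). (D ^^ i) ((fs @ [f]) ! j))"
  define P where "P = mat (Suc n) (Suc n) (\<lambda>(i, j).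
    if i = j then 1 else if i = n then c j else 0)"
  have MP: "M \<in> carrier_mat (Suc n) (Suc n)" "P \<in> carrier_mat (Suc n) (Suc n)"
    by (simp_all add: M_def P_def)
  have detP: "det P = 1"
  proof (subst det_lower_triangular[OF _ MP(2)])
    have "diag_mat P = map (\<lambda>_. 1) [0..<Suc n]"
      unfolding diag_mat_def by (rule map_cong) (auto simp: P_def)
    then show "prod_list (diag_mat P) = 1" by (simp add: map_replicate_const)
  qed (auto simp: P_def)
  have row: "(P * M) $$ (i, j) = (if i = n then A ((fs @ [f]) ! j) else M $$ (i, j))"
    if "i < Suc n" "j < Suc n" for i j
  proof -
    have "(P * M) $$ (i, j) = (\<Sum>r<Suc n. P $$ (i, r) * M $$ (r, j))"
      using that MP by (simp add: scalar_prod_def atLeast0LessThan)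
    also have "\<dots> = (if i = n then A ((fs @ [f]) ! j) else M $$ (i, j))"
    proof (cases "i = n")
      case True
      then show ?thesis using that by (simp add: c P_def M_def n_def)
    next
      case False
      then have "(\<Sum>r<Suc n. P $$ (i, r) * M $$ (r, j)) = (\<Sum>r<Suc n. if r = i then M $$ (i, j) else 0)"
        using that by (intro sum.cong) (auto simp: P_def)
      then show ?thesis using False that by simp
    qed
    finally show ?thesis .
  qed
  have last: "(P * M) $$ (n, j) = (if j = n then A f else 0)" if "j < Suc n" for j
    using that assms(2) by (auto simp: row nth_append n_def)
  have "wronskian D (fs @ [f]) = det M"
    by (simp add: wronskian_def M_def n_def)
  also have "\<dots> = det (P * M)"
    by (simp add: det_mult[OF MP(2,1)] detP)
  also have "\<dots> = (\<Sum>j<Suc n. (P * M) $$ (n, j) * cofactor (P * M) n j)"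
    by (rule laplace_expansion_row) (use MP in auto)
  also have "\<dots> = (\<Sum>j<Suc n. if j = n then A f * cofactor (P * M) n n else 0)"
    by (intro sum.cong) (auto simp: last)
  also have "\<dots> = A f * cofactor (P * M) n n" by simp
  also have "cofactor (P * M) n n = wronskian D fs"
  proof -
    have "mat_delete (P * M) n n = mat n n (\<lambda>(i, j). (D ^^ i) (fs ! j))"
    proof (rule eq_matI)
      fix i j assume ij: "i < dim_row (mat n n (\<lambda>(i, j). (D ^^ i) (fs ! j)))"
        "j < dim_col (mat n n (\<lambda>(i, j). (D ^^ i) (fs ! j)))"
      have "mat_delete (P * M) n n $$ (i, j) = (P * M) $$ (i, j)"
        using ij MP by (simp add: mat_delete_def)
      then show "mat_delete (P * M) n n $$ (i, j) = mat n n (\<lambda>(i, j). (D ^^ i) (fs ! j)) $$ (i, j)"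
        using ij by (simp add: row) (simp add: M_def nth_append n_def)
    qed (use MP in auto)
    then show ?thesis by (simp add: cofactor_def wronskian_def n_def)
  qed
  finally show ?thesis by (simp add: mult.commute)
qed

end

text \<open>What the Darboux construction uses of the Hermite polynomials: nonzero eigenfunctions of
  2y D^2 + x D whose eigenvalues are distinct in characteristic zero.\<close>

locale hermite_field = derivation D for D :: "'a::field_char_0 \<Rightarrow> 'a" +
  fixes X Y :: 'a and H :: "nat \<Rightarrow> 'a"
  assumes D_X: "D X = 1" and D_Y: "D Y = 0"
    and H_nonzero: "H n \<noteq> 0"
    and H_eigen: "2 * Y * D (D (H n)) + X * D (H n) = of_nat n * H n"
begin

definition EH :: "'a \<Rightarrow> 'a" where "EH f = 2 * Y * D (D f) + X * D f"

text \<open>Up to the factor $2y$, the derivatives of $f\,e^{x^2/4y}$ divided by $e^{x^2/4y}$.\<close>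

definition exact :: "'a \<Rightarrow> bool" where "exact f \<longleftrightarrow> (\<exists>h. f = 2 * Y * D h + X * h)"

lemma exact_add: "exact f \<Longrightarrow> exact g \<Longrightarrow> exact (f + g)"
  unfolding exact_def
proof (elim exE)
  fix h h' assume "f = 2 * Y * D h + X * h" "g = 2 * Y * D h' + X * h'"
  then show "\<exists>h. f + g = 2 * Y * D h + X * h"
    by (intro exI[of _ "h + h'"]) (simp add: D_add algebra_simps)
qed

lemma exact_cmult: "exact f \<Longrightarrow> D c = 0 \<Longrightarrow> exact (c * f)"
  unfolding exact_def
proof (elim exE)
  fix h assume "f = 2 * Y * D h + X * h" "D c = 0"
  then show "\<exists>h. c * f = 2 * Y * D h + X * h"
    by (intro exI[of _ "c * h"]) (simp add: D_mult algebra_simps)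
qed

lemma exact_diff: "exact f \<Longrightarrow> exact g \<Longrightarrow> exact (f - g)"
  using exact_add[of f "(-1) * g"] exact_cmult[of g "-1"] by (simp add: D_uminus)

text \<open>Iterated Darboux transformation: $A$ factors into first-order steps $\partial - v'/v$ with
  $v$ the image of the next Hermite function, and $B$ is its adjoint with respect to the weight
  $e^{x^2/4y}$. Every step conjugates the Hermite operator into one with an additional potential $V$.
  That $v \ne 0$ comes out of the induction, since $BA$ does not annihilate $H_k$ for a new $k$.\<close>

lemma darboux_chain:
  assumes "distinct ks"
  obtains A B V where "monic_op (length ks) A"
    and "\<And>k. k \<in> set ks \<Longrightarrow> A (H k) = 0"
    and "\<And>f. EH (A f) + V * A f = A (EH f)"
    and "\<And>n. B (A (H n)) = (\<Prod>k\<in>set ks. of_nat k - of_nat n) * H n"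
    and "\<And>a g h. D a = 0 \<Longrightarrow> B (a * g + h) = a * B g + B h"
    and "\<And>f g. exact (f * B g - (2 * Y) ^ length ks * A f * g)"
    and "wronskian D (map H ks) \<noteq> 0"
  using assms
proof (induction ks arbitrary: thesis rule: rev_induct)
  case Nil
  show ?case
  proof (rule Nil.prems(1)[of "\<lambda>f. f" 0 "\<lambda>f. f"])
    show "monic_op (length []) (\<lambda>f. f)" by (simp add: monic_op_def)
    show "exact (f * g - (2 * Y) ^ length [] * f * g)" for f g
      unfolding exact_def by (intro exI[of _ 0]) simp
    show "wronskian D (map H []) \<noteq> 0" by (simp add: wronskian_def)
  qed (auto simp: EH_def)
next
  case (snoc k ks)
  then have dist: "distinct ks" "k \<notin> set ks" by auto
  from snoc.IH[OF _ dist(1)] obtain A B V where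
      A: "monic_op (length ks) A" and ker: "\<And>k. k \<in> set ks \<Longrightarrow> A (H k) = 0"
    and inter: "\<And>f. EH (A f) + V * A f = A (EH f)"
    and BA: "\<And>n. B (A (H n)) = (\<Prod>k\<in>set ks. of_nat k - of_nat n) * H n"
    and Blin: "\<And>a g h. D a = 0 \<Longrightarrow> B (a * g + h) = a * B g + B h"
    and adj: "\<And>f g. exact (f * B g - (2 * Y) ^ length ks * A f * g)"
    and wr: "wronskian D (map H ks) \<noteq> 0" by blast
  define v where "v = A (H k)"
  have B0: "B 0 = 0" using Blin[of 1 0 0] by simp
  have "B v \<noteq> 0" using dist by (auto simp: v_def BA H_nonzero)
  then have v: "v \<noteq> 0" using B0 by auto
  define u where "u = D v / v"
  define A' where "A' f = D (A f) - u * A f" for f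
  \<comment> \<open>The weight has logarithmic derivative x/2y, so \<open>T\<close> is 2y times the
    formal adjoint of \<open>D - u\<close>. The factor 2y avoids a division and accumulates to
    \<open>(2 * Y) ^ length ks\<close>.\<close>
  define T where "T g = - 2 * Y * D g - X * g - 2 * Y * u * g" for g
  \<comment> \<open>Chosen so that (D - u) T = k - (EH + V'), while T (D - u) = k - (EH + V): the
    two factors change places.\<close>
  define V' where "V' = 1 + 2 * Y * D u - X * u - 2 * Y * u * u + of_nat k"
  have Dv: "D v = u * v" using v by (simp add: u_def)
  have Alin: "A (a * f + g) = a * A f + A g" if "D a = 0" for a f g
    using monic_op_linear[OF A that] .
  have A0: "A 0 = 0" using Alin[of 1 0 0] by simp
  have Acm: "A (a * f) = a * A f" if "D a = 0" for a f
    using Alin[OF that, of f 0] A0 by simp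
  have EHk: "EH (H n) = of_nat n * H n" for n by (simp add: EH_def H_eigen)
  have "EH v + V * v = of_nat k * v"
    using inter[of "H k"] by (simp add: EHk Acm v_def)
  then have pot_v: "(2 * Y * (D u + u * u) + X * u + V) * v = of_nat k * v"
    by (simp add: EH_def Dv D_mult algebra_simps)
  \<comment> \<open>The Riccati equation of the logarithmic derivative \<open>u\<close> of the
    eigenfunction \<open>v\<close>.\<close>
  have pot: "2 * Y * D u + 2 * Y * u * u + X * u = of_nat k - V"
  proof -
    have "(2 * Y * D u + 2 * Y * u * u + X * u + V) * v = of_nat k * v"
      using pot_v by (simp add: algebra_simps)
    then have "2 * Y * D u + 2 * Y * u * u + X * u + V = of_nat k" using v by simp
    then show ?thesis by (simp add: eq_diff_eq)
  qed
  have TD: "T (D f - u * f) = of_nat k * f - (EH f + V * f)" for f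
  proof -
    have "T (D f - u * f) = - EH f + (2 * Y * D u + 2 * Y * u * u + X * u) * f"
      by (simp add: T_def EH_def D_diff D_mult algebra_simps)
    then show ?thesis unfolding pot by (simp add: algebra_simps)
  qed
  have TA': "T (A' f) = of_nat k * A f - A (EH f)" for f
    using TD[of "A f"] inter[of f] by (simp add: A'_def)
  have Tlin: "T (a * f + g) = a * T f + T g" if "D a = 0" for a f g
    using that by (simp add: T_def D_add D_mult algebra_simps)
  show ?case
  proof (rule snoc.prems(1)[of A' V' "\<lambda>g. B (T g)"])
    show "monic_op (length (ks @ [k])) A'"
      using monic_op_Suc[OF A, of u] by (simp add: A'_def[abs_def])
    show "A' (H j) = 0" if "j \<in> set (ks @ [k])" for j
      using that by (auto simp: A'_def ker v_def[symmetric] Dv)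
    show "EH (A' f) + V' * A' f = A' (EH f)" for f
    proof -
      have "A' (EH f) = of_nat k * A' f - (D (T (A' f)) - u * T (A' f))"
        unfolding TA' by (simp add: A'_def D_diff D_mult algebra_simps)
      also have "D (T g) - u * T g = - (EH g + (V' - of_nat k) * g)" for g
        by (simp add: T_def EH_def V'_def D_diff D_add D_mult D_X D_Y D_uminus algebra_simps)
      finally show ?thesis by (simp add: algebra_simps)
    qed
    show "B (T (A' (H n))) = (\<Prod>k\<in>set (ks @ [k]). of_nat k - of_nat n) * H n" for n
    proof -
      have "T (A' (H n)) = (of_nat k - of_nat n) * A (H n) + 0"
        unfolding TA' EHk Acm[OF D_of_nat] by (simp add: algebra_simps)
      then show ?thesis
        using dist Blin[of "of_nat k - of_nat n" "A (H n)" 0] by (simp add: D_diff B0 BA)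
    qed
    show "B (T (a * g + h)) = a * B (T g) + B (T h)" if "D a = 0" for a g h
      using that by (simp add: Tlin Blin)
    show "exact (f * B (T g) - (2 * Y) ^ length (ks @ [k]) * A' f * g)" for f g
    proof -
      define h where "h = A f"
      have c: "D ((2 * Y) ^ length ks) = 0" by (rule D_power_const) (simp add: D_mult D_Y)
      \<comment> \<open>Integration by parts; the boundary term is the product of \<open>h\<close>
        and \<open>g\<close>, up to sign.\<close>
      have "exact (h * T g - 2 * Y * (D h - u * h) * g)"
        unfolding exact_def
        by (intro exI[of _ "- (h * g)"]) (simp add: T_def D_mult D_uminus algebra_simps)
      from exact_add[OF adj[of f "T g"] exact_cmult[OF this c]]
      show ?thesis by (simp add: A'_def h_def algebra_simps)
    qed
    show "wronskian D (map H (ks @ [k])) \<noteq> 0"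
    proof -
      have "wronskian D (map H ks @ [H k]) = wronskian D (map H ks) * A (H k)"
        by (rule wronskian_append) (use A ker in auto)
      then show ?thesis using wr v by (simp add: v_def)
    qed
  qed
qed

end

section \<open>Hermite polynomials and the Gaussian functional\<close>

lemma to_fract_of_nat: "to_fract (of_nat n) = of_nat n" by (induction n) (auto )

instance fract :: ("{idom,ring_char_0}") field_char_0
proof
 show "inj (of_nat :: nat \<Rightarrow> 'a fract)" by (rule injI) (simp flip: to_fract_of_nat)
qed
definition fract_deriv :: "'a::idom poly fract \<Rightarrow> 'a poly fract" where
  "fract_deriv r = (let (a, b) = SOME (a, b). b \<noteq> 0 \<and> r = Fract a b
     in Fract (pderiv a * b - a * pderiv b) (b * b))"

text \<open>The chosen representative does not matter: the cross-multiplied difference of the two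
  quotient rules is a combination of \<open>a * d - c * b\<close> and of its derivative.\<close>

lemma fract_deriv_Fract:
  assumes "b \<noteq> 0"
  shows "fract_deriv (Fract a b) = Fract (pderiv a * b - a * pderiv b) (b * b)"
proof -
  define p where "p = (SOME p. case p of (c, d) \<Rightarrow> d \<noteq> 0 \<and> Fract a b = Fract c d)"
  obtain c d where p: "p = (c, d)" by fastforce
  have "case p of (c, d) \<Rightarrow> d \<noteq> 0 \<and> Fract a b = Fract c d"
    unfolding p_def by (rule someI[of _ "(a, b)"]) (use assms in simp)
  then have d: "d \<noteq> 0" and eq: "a * d = c * b"
    using assms by (auto simp: p eq_fract)
  have eq': "pderiv a * d + a * pderiv d = pderiv c * b + c * pderiv b"
    using arg_cong[OF eq, of pderiv] by (simp add: pderiv_mult algebra_simps)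
  have "(pderiv c * d - c * pderiv d) * (b * b) - (pderiv a * b - a * pderiv b) * (d * d) =
     b * d * (pderiv c * b + c * pderiv b - (pderiv a * d + a * pderiv d))
     + (pderiv d * b + d * pderiv b) * (a * d - c * b)"
    by (simp add: algebra_simps)
  then have "(pderiv c * d - c * pderiv d) * (b * b) = (pderiv a * b - a * pderiv b) * (d * d)"
    using eq eq' by simp
  then show ?thesis
    using assms d p by (simp add: fract_deriv_def p_def eq_fract)
qed

lemma fract_deriv_to_fract: "fract_deriv (to_fract p) = to_fract (pderiv p)"
  by (simp add: fract_deriv_Fract to_fract_def)

lemma fract_deriv_add: "fract_deriv (a + b) = fract_deriv a + fract_deriv b"
  for a b :: "'a::idom poly fract"
  by (cases a, cases b)
    (simp add: fract_deriv_Fract eq_fract pderiv_mult pderiv_add algebra_simps)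

lemma fract_deriv_mult: "fract_deriv (a * b) = fract_deriv a * b + a * fract_deriv b"
  for a b :: "'a::idom poly fract"
  by (cases a, cases b)
    (simp add: fract_deriv_Fract eq_fract pderiv_mult pderiv_add algebra_simps)

section \<open>Recurrence, derivative and eigenvalue equation of the Hermite polynomials\<close>

lemma pderiv_varx [simp]: "pderiv varx = 1"
  by (simp add: varx_def pderiv_pCons one_pCons)

lemma pderiv_vary [simp]: "pderiv vary = 0"
  by (simp add: vary_def pderiv_pCons)

lemma exp_xyz_deriv:
  "fps_deriv exp_xyz = exp_xyz * (fps_const varx + fps_const (2 * vary) * fps_X)"
proof -
  let ?E = "Abs_fps (\<lambda>n. [:[:1 / fact n:]:]) :: complex poly poly fps"
  let ?u = "fps_const varx * fps_X + fps_const vary * fps_X ^ 2"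
  have "fps_deriv ?E = ?E"
  proof (rule fps_ext)
    fix n
    have "(of_nat (n + 1) :: complex poly poly) = [:[:of_nat (n + 1):]:]"
      by (simp add: of_nat_poly)
    moreover have "of_nat (n + 1) * (1 / fact (n + 1)) = (1 / fact n :: complex)"
      by (simp only: Suc_eq_plus1[symmetric] fact_Suc) (simp del: of_nat_Suc)
    ultimately show "fps_deriv ?E $ n = ?E $ n"
      by (simp del: of_nat_Suc of_nat_add)
  qed
  moreover have "fps_deriv ?u = fps_const varx + fps_const (2 * vary) * fps_X"
    by (simp add: power2_eq_square algebra_simps flip: fps_const_add mult_2)
  ultimately show ?thesis
    unfolding exp_xyz_def by (simp add: fps_compose_deriv)
qed

lemma exp_xyz_0: "fps_nth exp_xyz 0 = 1"
  by (simp add: exp_xyz_def fps_compose_nth one_pCons)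

lemma exp_xyz_Suc:
  "of_nat (Suc n) * fps_nth exp_xyz (Suc n) =
     varx * fps_nth exp_xyz n + (if n = 0 then 0 else 2 * vary * fps_nth exp_xyz (n - 1))"
proof -
  have "of_nat (Suc n) * fps_nth exp_xyz (Suc n) = fps_nth (fps_deriv exp_xyz) n"
    by simp
  also have "\<dots> = varx * fps_nth exp_xyz n + (if n = 0 then 0 else 2 * vary * fps_nth exp_xyz (n - 1))"
    unfolding exp_xyz_deriv
    by (simp add: algebra_simps fps_mult_right_const_nth flip: mult.assoc)
  finally show ?thesis .
qed

lemma hermite_0: "hermite 0 = 1"
  by (simp add: hermite_def exp_xyz_0)

lemma hermite_Suc:
  "hermite (Suc n) = varx * hermite n + 2 * vary * (of_nat n * hermite (n - 1))"
proof -
  have "hermite (Suc n) = fact n * (of_nat (Suc n) * fps_nth exp_xyz (Suc n))"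
    by (simp add: hermite_def algebra_simps)
  also have "\<dots> = varx * hermite n + 2 * vary * (of_nat n * hermite (n - 1))"
    unfolding exp_xyz_Suc by (cases n) (simp_all add: hermite_def algebra_simps)
  finally show ?thesis .
qed

lemma pderiv_hermite: "pderiv (hermite n) = of_nat n * hermite (n - 1)"
proof (induction n rule: less_induct)
  case (less n)
  show ?case
  proof (cases n)
    case 0
    then show ?thesis by (simp add: hermite_0)
  next
    case (Suc m)
    have m: "pderiv (hermite m) = of_nat m * hermite (m - 1)"
      "pderiv (hermite (m - 1)) = of_nat (m - 1) * hermite (m - 1 - 1)"
      using less.IH Suc by auto
    have "pderiv (hermite (Suc m)) = hermite m + of_nat m *
        (varx * hermite (m - 1) + 2 * vary * (of_nat (m - 1) * hermite (m - 1 - 1)))"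
      unfolding hermite_Suc by (simp add: pderiv_add pderiv_mult m algebra_simps del: One_nat_def)
    also have "of_nat m * (varx * hermite (m - 1) + 2 * vary * (of_nat (m - 1) * hermite (m - 1 - 1)))
        = of_nat m * hermite m"
      by (cases m) (simp_all add: hermite_Suc)
    finally show ?thesis by (simp add: Suc algebra_simps)
  qed
qed

text \<open>The raising operator x + 2y D is the very operator that defines \<open>exact\<close>;
  this makes integration by parts against Hermite polynomials immediate.\<close>

lemma hermite_rec: "hermite (Suc n) = varx * hermite n + 2 * vary * pderiv (hermite n)"
  by (simp add: pderiv_hermite hermite_Suc)

lemma hermite_eigen:
  "2 * vary * pderiv (pderiv (hermite n)) + varx * pderiv (hermite n) = of_nat n * hermite n"
proof (cases n)
  case 0
  then show ?thesis by (simp add: hermite_0)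
next
  case (Suc m)
  then have d: "pderiv (hermite n) = of_nat n * hermite m"
    by (simp add: pderiv_hermite)
  have "2 * vary * pderiv (pderiv (hermite n)) + varx * pderiv (hermite n) =
      of_nat n * (varx * hermite m + 2 * vary * pderiv (hermite m))"
    unfolding d by (simp add: pderiv_mult algebra_simps)
  then show ?thesis by (simp add: Suc hermite_rec)
qed

lemma higher_pderiv_hermite: "(pderiv ^^ n) (hermite n) = fact n"
proof (induction n)
  case (Suc n)
  have "(pderiv ^^ Suc n) (hermite (Suc n)) = (pderiv ^^ n) (pderiv (hermite (Suc n)))"
    by (simp add: funpow_swap1)
  also have "pderiv (hermite (Suc n)) = Polynomial.smult (of_nat (Suc n)) (hermite n)"
    by (simp add: pderiv_hermite of_nat_poly)
  also have "(pderiv ^^ n) \<dots> = Polynomial.smult (of_nat (Suc n)) (fact n)"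
    by (simp add: higher_pderiv_smult Suc)
  finally show ?case by (simp add: of_nat_poly algebra_simps)
qed (simp add: hermite_0)

lemma pderiv_fact: "pderiv (fact n :: 'a::{idom,ring_char_0} poly) = 0"
  by (metis of_nat_fact pderiv_of_nat)

lemma higher_pderiv_hermite_eq_0: "m < n \<Longrightarrow> (pderiv ^^ n) (hermite m) = 0"
proof (induction n)
  case (Suc n)
  then show ?case by (cases "m = n") (auto simp: higher_pderiv_hermite pderiv_fact)
qed simp

lemma hermite_nonzero: "hermite n \<noteq> 0"
  using higher_pderiv_hermite[of n] by (metis fact_nonzero higher_pderiv_0)

text \<open>Moments of a Gaussian of formal variance -2y. The two-step recursion is what vanishing
  on \<open>2 * vary * pderiv p + varx * p\<close> requires for p = x^(n+1); p = 1 gives the value 0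
  at index 1.\<close>

fun moment :: "nat \<Rightarrow> complex poly" where
  "moment 0 = 1"
| "moment (Suc 0) = 0"
| "moment (Suc (Suc n)) = - 2 * [:0, 1:] * of_nat (Suc n) * moment n"

text \<open>The normalised integral against the weight $e^{x^2/4y}$.\<close>

definition gauss :: "complex poly poly \<Rightarrow> complex poly" where
  "gauss p = (\<Sum>i\<le>degree p. coeff p i * moment i)"

lemma gauss_altdef: "degree p \<le> n \<Longrightarrow> gauss p = (\<Sum>i\<le>n. coeff p i * moment i)"
  unfolding gauss_def by (rule sum.mono_neutral_left) (auto simp: coeff_eq_0)

lemma gauss_add: "gauss (p + q) = gauss p + gauss q"
proof -
  define n where "n = max (degree p) (degree q)"
  have "degree (p + q) \<le> n" by (simp add: n_def degree_add_le)
  then show ?thesis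
    by (simp add: gauss_altdef[of _ n] n_def sum.distrib algebra_simps)
qed

lemma gauss_smult: "gauss (Polynomial.smult c p) = c * gauss p"
  by (simp add: gauss_altdef[of _ "degree p"] degree_smult_le sum_distrib_left mult.assoc)

lemma gauss_0 [simp]: "gauss 0 = 0"
  by (simp add: gauss_def)

lemma gauss_diff: "gauss (p - q) = gauss p - gauss q"
proof -
  have "gauss (p + Polynomial.smult (-1) q) = gauss p + (-1) * gauss q"
    by (simp only: gauss_add gauss_smult)
  then show ?thesis by simp
qed

lemma gauss_sum: "gauss (\<Sum>i\<in>A. f i) = (\<Sum>i\<in>A. gauss (f i))"
  by (induction A rule: infinite_finite_induct) (auto simp: gauss_add)

lemma gauss_exact: "gauss (2 * vary * pderiv p + varx * p) = 0"
proof -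
  define n where "n = degree p"
  define y :: "complex poly" where "y = [:0, 1:]"
  have "gauss (varx * p) = (\<Sum>i\<le>Suc n. coeff (pCons 0 p) i * moment i)"
    by (simp add: varx_def gauss_altdef[of _ "Suc n"] n_def degree_pCons_le)
  also have "\<dots> = (\<Sum>i\<le>n. coeff p i * moment (Suc i))"
    by (simp add: sum.atMost_Suc_shift del: sum.atMost_Suc)
  also have "\<dots> = (\<Sum>i<n. coeff p (Suc i) * moment (Suc (Suc i)))"
    by (simp only: lessThan_Suc_atMost[symmetric] sum.lessThan_Suc_shift) simp
  finally have 1: "gauss (varx * p) = - (2 * y * (\<Sum>i<n. of_nat (Suc i) * coeff p (Suc i) * moment i))"
    unfolding y_def by (simp add: sum_distrib_left algebra_simps flip: sum_negf)
  have "gauss (pderiv p) = (\<Sum>i<n. coeff (pderiv p) i * moment i)"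
  proof (cases n)
    case 0
    then have "pderiv p = 0" by (simp add: n_def pderiv_eq_0_iff)
    then show ?thesis by simp
  next
    case (Suc k)
    then show ?thesis
      by (simp add: gauss_altdef[of _ k] degree_pderiv n_def lessThan_Suc_atMost)
  qed
  then have 2: "gauss (pderiv p) = (\<Sum>i<n. of_nat (Suc i) * coeff p (Suc i) * moment i)"
    by (simp add: coeff_pderiv)
  have "2 * vary * pderiv p = Polynomial.smult (2 * y) (pderiv p)"
    by (simp add: vary_def y_def numeral_poly)
  then have "gauss (2 * vary * pderiv p) = 2 * y * gauss (pderiv p)"
    by (simp only: gauss_smult)
  then show ?thesis by (simp add: gauss_add 1 2)
qed

text \<open>H_n is the n-th power of the raising operator applied to 1, and the adjoint of the
  raising operator is -2y D.\<close>

lemma gauss_hermite_mult: "gauss (hermite n * p) = (- 2 * [:0, 1:]) ^ n * gauss ((pderiv ^^ n) p)"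
proof (induction n arbitrary: p)
  case (Suc n)
  have "hermite (Suc n) * p = (2 * vary * pderiv (hermite n * p) + varx * (hermite n * p))
      - Polynomial.smult (2 * [:0, 1:]) (hermite n * pderiv p)"
    by (simp add: hermite_rec pderiv_mult vary_def numeral_poly algebra_simps)
  then have "gauss (hermite (Suc n) * p) = - 2 * [:0, 1:] * gauss (hermite n * pderiv p)"
    by (simp only: gauss_diff gauss_exact gauss_smult) simp
  then show ?case by (simp add: Suc funpow_swap1)
qed (simp add: hermite_0)

lemma gauss_hermite:
  "gauss (hermite n * hermite m) = (if n = m then (- 2 * [:0, 1:]) ^ n * fact n else 0)"
proof -
  have *: "gauss (hermite n * hermite m) = 0" if "m < n" for m n
    by (simp add: gauss_hermite_mult higher_pderiv_hermite_eq_0[OF that])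
  have "gauss (fact n) = fact n" for n
  proof -
    have "(fact n :: complex poly poly) = [:fact n:]"
      using of_nat_poly[of "fact n", where ?'a = "complex poly"] by (simp only: of_nat_fact)
    then show ?thesis by (simp add: gauss_def)
  qed
  then have "gauss (hermite n * hermite n) = (- 2 * [:0, 1:]) ^ n * fact n"
    by (simp add: gauss_hermite_mult higher_pderiv_hermite)
  then show ?thesis
    using *[of m n] *[of n m] by (cases n m rule: linorder_cases) (auto simp: mult.commute)
qed

text \<open>With h = u/v in lowest terms, clearing denominators gives v | 2y u v', hence v | 2y v'
  by coprimality. Comparing degrees in x shows that v does not involve x.\<close>

lemma gauss_eq_0_of_fract_exact:
  assumes "to_fract p = 2 * to_fract vary * fract_deriv h + to_fract varx * h"
  shows "gauss p = 0"
proof -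
  define u v where "u = fst (quot_of_fract h)" and "v = snd (quot_of_fract h)"
  have h: "h = Fract u v" and v0: "v \<noteq> 0" and cop: "coprime v u"
    using coprime_quot_of_fract[of h] by (auto simp: u_def v_def coprime_commute)
  have two: "(2 :: complex poly poly fract) = Fract 2 1"
    by (metis to_fract_def to_fract_of_nat of_nat_numeral)
  have "Fract p 1 = Fract (2 * vary * (pderiv u * v - u * pderiv v) * v + varx * u * (v * v)) (v * v * v)"
    using assms v0 by (simp add: h fract_deriv_Fract to_fract_def two)
  then have "v * (p * v * v) = v * (2 * vary * (pderiv u * v - u * pderiv v) + varx * u * v)"
    using v0 by (simp add: eq_fract algebra_simps)
  then have eq: "p * v * v = 2 * vary * (pderiv u * v - u * pderiv v) + varx * u * v"
    using v0 by simp
  then have "u * (2 * vary * pderiv v) = v * (2 * vary * pderiv u + varx * u - p * v)"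
    by (simp add: algebra_simps)
  then have "v dvd u * (2 * vary * pderiv v)" by simp
  then have "v dvd 2 * vary * pderiv v"
    using coprime_dvd_mult_right_iff[OF cop] by blast
  also have "2 * vary * pderiv v = Polynomial.smult (2 * [:0, 1:]) (pderiv v)"
    by (simp add: vary_def numeral_poly)
  finally have dvd: "v dvd Polynomial.smult (2 * [:0, 1:]) (pderiv v)" .
  have "degree v = 0"
  proof (rule ccontr)
    assume deg: "degree v \<noteq> 0"
    then have "pderiv v \<noteq> 0" by (simp add: pderiv_eq_0_iff)
    then have "degree v \<le> degree (Polynomial.smult (2 * [:0, 1:]) (pderiv v))"
      using dvd by (intro dvd_imp_degree_le) auto
    also have "\<dots> \<le> degree v - 1" by (simp add: degree_pderiv degree_smult_le)
    finally show False using deg by simp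
  qed
  \<comment> \<open>The denominator may still depend on y. As \<open>gauss\<close> is linear over
    C[y], this factor is moved to the side of \<open>p\<close> and cancelled after
    integration.\<close>
  then obtain c where c: "v = [:c:]" by (meson degree_eq_zeroE)
  then have "c \<noteq> 0" using v0 by simp
  have "v * (p * v) = v * (2 * vary * pderiv u + varx * u)"
    using eq by (simp add: c pderiv_pCons algebra_simps)
  then have "p * v = 2 * vary * pderiv u + varx * u" using v0 by simp
  then have "Polynomial.smult c p = 2 * vary * pderiv u + varx * u" by (simp add: c)
  then have "gauss (Polynomial.smult c p) = 0" by (simp only: gauss_exact)
  then show ?thesis using \<open>c \<noteq> 0\<close> by (simp add: gauss_smult)
qed

interpretation hermite: hermite_field
  "fract_deriv :: complex poly poly fract \<Rightarrow> complex poly poly fract"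
  "to_fract varx" "to_fract vary" "\<lambda>n. to_fract (hermite n)"
proof
  show "2 * to_fract vary * fract_deriv (fract_deriv (to_fract (hermite n)))
      + to_fract varx * fract_deriv (to_fract (hermite n)) = of_nat n * to_fract (hermite n)" for n
    using arg_cong[OF hermite_eigen[of n], of to_fract]
    by (simp add: fract_deriv_to_fract to_fract_of_nat flip: to_fract_of_nat[of 2, simplified])
qed (simp_all add: fract_deriv_add fract_deriv_mult fract_deriv_to_fract hermite_nonzero)

section \<open>Scalars as constants of the derivation\<close>

interpretation to_fract: inj_comm_ring_hom to_fract
  by unfold_locales auto

definition cst :: "complex poly \<Rightarrow> complex poly poly fract" where
  "cst a = to_fract [:a:]"

interpretation cst: inj_comm_ring_hom cst
  by unfold_locales (auto simp: cst_def one_pCons[symmetric] simp flip: to_fract_mult to_fract_add)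

definition scl :: "complex \<Rightarrow> complex poly poly fract" where
  "scl c = cst [:c:]"

interpretation scl: inj_comm_ring_hom scl
  by unfold_locales (auto simp: scl_def one_pCons[symmetric] simp flip: cst.hom_mult cst.hom_add)

lemma fract_deriv_cst [simp]: "fract_deriv (cst a) = 0"
  by (simp add: cst_def fract_deriv_to_fract pderiv_pCons)

lemma fract_deriv_scl [simp]: "fract_deriv (scl c) = 0"
  by (simp add: scl_def)

lemma cst_mult_to_fract: "cst a * to_fract p = to_fract (Polynomial.smult a p)"
  by (simp add: cst_def flip: to_fract_mult)

lemma scl_mult_to_fract: "scl c * to_fract p = to_fract (Polynomial.smult [:c:] p)"
  by (simp add: scl_def cst_mult_to_fract)

lemma scl_mult_cst: "scl c * cst a = cst (Polynomial.smult c a)"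
  by (simp add: scl_def flip: cst.hom_mult)

lemma to_fract_wronskian:
  "to_fract (wronskian pderiv fs) = wronskian fract_deriv (map to_fract fs)"
  for fs :: "'a::idom poly list"
proof -
  have *: "(fract_deriv ^^ i) (to_fract p) = to_fract ((pderiv ^^ i) p)" for i and p :: "'a poly"
    by (induction i) (auto simp: fract_deriv_to_fract)
  show ?thesis
    unfolding wronskian_def to_fract.hom_det[symmetric]
    by (intro arg_cong[of _ _ det] eq_matI) (auto simp: *)
qed

section \<open>Partitions\<close>

locale partition =
  fixes lam :: "nat \<Rightarrow> nat"
  assumes lam: "is_partition lam"
begin

lemma lam_antimono: "i \<le> j \<Longrightarrow> 1 \<le> i \<Longrightarrow> lam j \<le> lam i"
proof (induction j rule: dec_induct)
  case (step j)
  then have "lam (Suc j) \<le> lam j" using lam by (auto simp: is_partition_def)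
  then show ?case using step by simp
qed simp

lemma lam_support: "{i. 1 \<le> i \<and> lam i \<noteq> 0} = {1..plen lam}"
proof -
  define S where "S = {i. 1 \<le> i \<and> lam i \<noteq> 0}"
  have fin: "finite S" using lam by (auto simp: is_partition_def S_def)
  have "\<exists>n. S = {1..n}"
  proof (cases "S = {}")
    case False
    have "S = {1..Max S}"
    proof
      show "S \<subseteq> {1..Max S}" using fin by (auto simp: S_def)
      show "{1..Max S} \<subseteq> S"
      proof
        fix i assume "i \<in> {1..Max S}"
        then have "lam (Max S) \<le> lam i" "1 \<le> i" using lam_antimono by auto
        then show "i \<in> S" using Max_in[OF fin False] by (auto simp: S_def)
      qed
    qed
    then show ?thesis ..
  qed (auto intro: exI[of _ 0])
  then obtain n where n: "S = {1..n}" ..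
  moreover have "plen lam = n" unfolding plen_def S_def[symmetric] n by simp
  ultimately show ?thesis by (simp add: S_def)
qed

lemma lam_eq_0_iff: "1 \<le> i \<Longrightarrow> lam i = 0 \<longleftrightarrow> plen lam < i"
proof -
  have "i \<in> {i. 1 \<le> i \<and> lam i \<noteq> 0} \<longleftrightarrow> i \<in> {1..plen lam}"
    by (simp only: lam_support)
  then show "1 \<le> i \<Longrightarrow> lam i = 0 \<longleftrightarrow> plen lam < i" by auto
qed

lemma mpart_gt: "i \<in> {1..plen lam} \<Longrightarrow> - int (plen lam) < mpart lam i"
  using lam_eq_0_iff[of i] by (auto simp: mpart_def)

lemma mpart_less: "1 \<le> i \<Longrightarrow> i < j \<Longrightarrow> mpart lam j < mpart lam i"
  using lam_antimono[of i j] by (simp add: mpart_def)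

text \<open>Beyond the length l the entries are 0, so m_i = -i fills everything below -l. The other
  m_i exceed -l since their entries are at least 1; in particular -l itself lies in J, with seed
  polynomial H_0.\<close>

lemma Mset_eq: "Mset lam = mpart lam ` {1..plen lam} \<union> {..< - int (plen lam)}"
proof -
  have "mpart lam i = - int i" if "i > plen lam" for i
    using that lam_eq_0_iff[of i] by (simp add: mpart_def)
  moreover have "{1..} = {1..plen lam} \<union> {plen lam<..}" by auto
  ultimately have "Mset lam = mpart lam ` {1..plen lam} \<union> (\<lambda>i. - int i) ` {plen lam<..}"
    by (simp add: Mset_def image_Un)
  moreover have "(\<lambda>i. - int i) ` {plen lam<..} = {..< - int (plen lam)}"
  proof safe
    fix m assume "m < - int (plen lam)"
    then show "m \<in> (\<lambda>i. - int i) ` {plen lam<..}"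
      by (intro image_eqI[of _ _ "nat (- m)"]) auto
  qed auto
  ultimately show ?thesis by simp
qed

lemma Jset_iff:
  "m \<in> Jset lam \<longleftrightarrow> - int (plen lam) \<le> m \<and> (\<forall>i\<in>{1..plen lam}. m \<noteq> mpart lam i)"
  by (auto simp: Jset_def Mset_eq)

lemma Mset_less: "m \<in> Mset lam \<Longrightarrow> m < int (lam 1)"
  using lam_antimono[of 1] by (fastforce simp: Mset_def mpart_def)

text \<open>Supplies infinitely many admissible indices, enough to prove identities between
  polynomials in m.\<close>

lemma Jset_large: "int (lam 1) \<le> m \<Longrightarrow> m \<in> Jset lam"
  using Mset_less by (force simp: Jset_def)

lemma int_kpart: "i \<in> {1..plen lam} \<Longrightarrow> int (kpart lam i) = mpart lam i + int (plen lam)"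
  using mpart_gt[of i] by (simp add: kpart_def)

lemma inj_on_kpart: "inj_on (kpart lam) {1..plen lam}"
proof (rule inj_onI)
  fix i j assume ij: "i \<in> {1..plen lam}" "j \<in> {1..plen lam}" "kpart lam i = kpart lam j"
  then have "mpart lam i = mpart lam j" using int_kpart[of i] int_kpart[of j] by simp
  then show "i = j"
    using ij mpart_less[of i j] mpart_less[of j i] by (cases i j rule: linorder_cases) auto
qed

text \<open>With n = m + l this is the product of the n - k_i: at once the normalising factor of R_m
  and, up to the sign (-1)^l, the eigenvalue of B A on H_n.\<close>

definition mprod :: "int \<Rightarrow> complex" where
  "mprod m = (\<Prod>i=1..plen lam. of_int (m - mpart lam i))"

lemma mprod_nonzero: "m \<in> Jset lam \<Longrightarrow> mprod m \<noteq> 0"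
  by (auto simp: mprod_def Jset_iff)

definition khermites where "khermites = map (kpart lam) (rev [1..<Suc (plen lam)])"

lemma hermites_eq: "hermites lam = map hermite khermites"
  by (simp add: hermites_def khermites_def)

lemma set_khermites: "set khermites = kpart lam ` {1..plen lam}"
  by (auto simp: khermites_def)

lemma distinct_khermites: "distinct khermites"
proof -
  have "set (rev [1..<Suc (plen lam)]) = {1..plen lam}" by auto
  then show ?thesis unfolding khermites_def distinct_map using inj_on_kpart by simp
qed

end

section \<open>Exceptional Hermite polynomials\<close>

context partition begin

definition lhermite :: "int \<Rightarrow> complex poly poly" where
  "lhermite m = hermite (nat (m + int (plen lam)))"

lemma wronskian_hermites_nonzero: "wronskian pderiv (hermites lam) \<noteq> 0"
proof -
  obtain A B and V :: "complex poly poly fract" where wr: "wronskian fract_deriv (map (\<lambda>k. to_fract (hermite k)) khermites) \<noteq> 0"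
    using hermite.darboux_chain[OF distinct_khermites] by blast
  have "to_fract (wronskian pderiv (hermites lam)) =
      wronskian fract_deriv (map (\<lambda>k. to_fract (hermite k)) khermites)"
    unfolding to_fract_wronskian hermites_eq map_map o_def ..
  with wr show ?thesis by auto
qed

lemma prod_khermites:
  assumes "m \<in> Jset lam"
  shows "(\<Prod>k\<in>set khermites. of_nat k - of_nat (nat (m + int (plen lam)))) =
    (- 1) ^ plen lam * scl (mprod m)"
proof -
  define n where "n = nat (m + int (plen lam))"
  have n: "int n = m + int (plen lam)" using assms by (auto simp: n_def Jset_iff)
  have "(\<Prod>k\<in>set khermites. of_nat k - of_nat n) =
      (\<Prod>i=1..plen lam. (of_nat (kpart lam i) - of_nat n :: complex poly poly fract))"
    unfolding set_khermites prod.reindex[OF inj_on_kpart] o_def ..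
  also have "\<dots> = (\<Prod>i=1..plen lam. (- 1) * scl (of_int (m - mpart lam i)))"
  proof (intro prod.cong refl)
    fix i assume "i \<in> {1..plen lam}"
    then have "int (kpart lam i) - int n = - (m - mpart lam i)"
      using int_kpart n by simp
    then have "of_nat (kpart lam i) - of_nat n = (of_int (- (m - mpart lam i)) :: complex poly poly fract)"
      by (metis of_int_diff of_int_of_nat_eq)
    then show "of_nat (kpart lam i) - of_nat n = (- 1) * scl (of_int (m - mpart lam i))"
      unfolding scl.hom_of_int by (simp only: of_int_minus mult_minus1)
  qed
  also have "\<dots> = (- 1) ^ plen lam * scl (mprod m)"
    unfolding prod.distrib mprod_def scl.hom_prod by simp
  finally show ?thesis by (simp only: n_def)
qed

text \<open>By \<open>wronskian_append\<close> the quotient of Wronskians in R_m is A H_(m+l);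
  division by \<open>mprod m\<close> cancels the eigenvalue of B A, so B R_m is a Hermite polynomial
  up to sign. The last conclusion says that A kills the seeds H_(k_i), whence the missing terms of
  \<Psi>.\<close>

lemma adjoint_darboux:
  obtains B where
    "\<And>m. m \<in> Jset lam \<Longrightarrow> B (exc_hermite lam m) = (- 1) ^ plen lam * to_fract (lhermite m)"
    and "\<And>a g h. fract_deriv a = 0 \<Longrightarrow> B (a * g + h) = a * B g + B h"
    and "\<And>m g. m \<in> Jset lam \<Longrightarrow> hermite.exact (to_fract (lhermite m) * B g -
      (2 * to_fract vary) ^ plen lam * (scl (mprod m) * exc_hermite lam m) * g)"
    and "\<And>i. i \<in> {1..plen lam} \<Longrightarrow>
      wronskian pderiv (hermites lam @ [hermite (kpart lam i)]) = 0"
proof -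
  obtain A B V where A: "hermite.monic_op (length khermites) A"
    and ker: "\<And>k. k \<in> set khermites \<Longrightarrow> A (to_fract (hermite k)) = 0"
    and "\<And>f. hermite.EH (A f) + V * A f = A (hermite.EH f)"
    and BA: "\<And>n. B (A (to_fract (hermite n))) =
      (\<Prod>k\<in>set khermites. of_nat k - of_nat n) * to_fract (hermite n)"
    and Blin: "\<And>a g h. fract_deriv a = 0 \<Longrightarrow> B (a * g + h) = a * B g + B h"
    and adj: "\<And>f g. hermite.exact (f * B g - (2 * to_fract vary) ^ length khermites * A f * g)"
    and "wronskian fract_deriv (map (\<lambda>k. to_fract (hermite k)) khermites) \<noteq> 0"
    by (rule hermite.darboux_chain[OF distinct_khermites]) (rule that, assumption+)
  have len: "length khermites = plen lam" by (simp add: khermites_def)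
  have wr: "to_fract (wronskian pderiv (hermites lam @ [p])) =
      to_fract (wronskian pderiv (hermites lam)) * A (to_fract p)" for p
  proof -
    have "wronskian fract_deriv (map to_fract (hermites lam) @ [to_fract p]) =
        wronskian fract_deriv (map to_fract (hermites lam)) * A (to_fract p)"
      by (rule hermite.wronskian_append) (use A ker in \<open>auto simp: hermites_eq\<close>)
    then show ?thesis by (simp add: to_fract_wronskian)
  qed
  have R: "exc_hermite lam m = scl (1 / mprod m) * A (to_fract (lhermite m))" for m
  proof -
    have "Fract (wronskian pderiv (hermites lam @ [lhermite m])) (wronskian pderiv (hermites lam))
        = A (to_fract (lhermite m))"
      unfolding Fract_conv_to_fract wr using wronskian_hermites_nonzero by simp
    then show ?thesis by (simp add: exc_hermite_def mprod_def lhermite_def scl_def cst_def)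
  qed
  have B0: "B 0 = 0" using Blin[of 1 0 0] by simp
  have Bcm: "B (a * g) = a * B g" if "fract_deriv a = 0" for a g
    using Blin[OF that, of g 0] B0 by simp
  have mprod_inv: "scl (mprod m) * scl (1 / mprod m) = 1" if "m \<in> Jset lam" for m
    using mprod_nonzero[OF that] by (simp flip: scl.hom_mult)
  have AR: "A (to_fract (lhermite m)) = scl (mprod m) * exc_hermite lam m" if "m \<in> Jset lam" for m
    unfolding R mult.assoc[symmetric] mprod_inv[OF that] by simp
  show ?thesis
  proof
    fix m assume m: "m \<in> Jset lam"
    have "B (A (to_fract (lhermite m))) = (- 1) ^ plen lam * scl (mprod m) * to_fract (lhermite m)"
      unfolding lhermite_def BA prod_khermites[OF m] ..
    then have "B (exc_hermite lam m) =
        (scl (mprod m) * scl (1 / mprod m)) * ((- 1) ^ plen lam * to_fract (lhermite m))"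
      unfolding R Bcm[OF fract_deriv_scl] by (simp only: mult_ac)
    then show "B (exc_hermite lam m) = (- 1) ^ plen lam * to_fract (lhermite m)"
      unfolding mprod_inv[OF m] by simp
    show "hermite.exact (to_fract (lhermite m) * B g -
        (2 * to_fract vary) ^ plen lam * (scl (mprod m) * exc_hermite lam m) * g)" for g
      using adj[of "to_fract (lhermite m)" g] by (simp only: len AR[OF m])
  next
    fix i assume "i \<in> {1..plen lam}"
    then have "to_fract (wronskian pderiv (hermites lam @ [hermite (kpart lam i)])) = 0"
      unfolding wr using ker[of "kpart lam i"] by (simp add: set_khermites)
    then show "wronskian pderiv (hermites lam @ [hermite (kpart lam i)]) = 0" by simp
  qed (fact Blin)
qed

text \<open>Multiplication by \<open>\<sigma>\<close> is symmetric for the bilinear form with weight $e^{x^2/4y}$, for which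
  the exceptional polynomials are orthogonal.\<close>

lemma recurrence_symmetric:
  fixes a :: "int \<Rightarrow> int \<Rightarrow> complex poly"
  assumes rec: "\<And>m. m \<in> Jset lam \<Longrightarrow>
      to_fract \<sigma> * exc_hermite lam m = (\<Sum>n\<in>S m. cst (a m n) * exc_hermite lam n)"
    and S: "\<And>m. finite (S m)" "\<And>m. S m \<subseteq> Jset lam" "\<And>m n. n \<notin> S m \<Longrightarrow> a m n = 0"
    and m: "m \<in> Jset lam" and n: "n \<in> Jset lam"
  shows "Polynomial.smult (mprod m) (a m n) * (- 2 * [:0, 1:]) ^ nat (n + int (plen lam)) * fact (nat (n + int (plen lam)))
    = Polynomial.smult (mprod n) (a n m) * (- 2 * [:0, 1:]) ^ nat (m + int (plen lam)) * fact (nat (m + int (plen lam)))"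
proof -
  obtain B where BR: "\<And>m. m \<in> Jset lam \<Longrightarrow> B (exc_hermite lam m) = (- 1) ^ plen lam * to_fract (lhermite m)"
    and Blin: "\<And>a g h. fract_deriv a = 0 \<Longrightarrow> B (a * g + h) = a * B g + B h"
    and adj: "\<And>m g. m \<in> Jset lam \<Longrightarrow> hermite.exact (to_fract (lhermite m) * B g -
      (2 * to_fract vary) ^ plen lam * (scl (mprod m) * exc_hermite lam m) * g)"
    and "\<And>i. i \<in> {1..plen lam} \<Longrightarrow>
      wronskian pderiv (hermites lam @ [hermite (kpart lam i)]) = 0"
    by (rule adjoint_darboux) (rule that, assumption+)
  have B0: "B 0 = 0" using Blin[of 1 0 0] by simp
  have Bsum: "B (\<Sum>i\<in>F. cst (f i) * g i) = (\<Sum>i\<in>F. cst (f i) * B (g i))" if "finite F" for F f g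
    using that by (induction F) (simp_all add: B0 Blin)
  \<comment> \<open>Up to sign this is B applied to \<sigma> R_m: a polynomial, because B turns the
    recurrence into one for Hermite polynomials.\<close>
  define T where "T m = (\<Sum>n\<in>S m. Polynomial.smult (a m n) (lhermite n))" for m
  have BT: "B (to_fract \<sigma> * exc_hermite lam m) = (- 1) ^ plen lam * to_fract (T m)"
    if "m \<in> Jset lam" for m
  proof -
    have "B (to_fract \<sigma> * exc_hermite lam m) =
        (\<Sum>n\<in>S m. cst (a m n) * ((- 1) ^ plen lam * to_fract (lhermite n)))"
      unfolding rec[OF that] Bsum[OF S(1)] using S(2) BR by (intro sum.cong) auto
    also have "\<dots> = (- 1) ^ plen lam * to_fract (T m)"
      unfolding T_def to_fract.hom_sum sum_distrib_left
      by (intro sum.cong) (simp_all add: cst_mult_to_fract[symmetric] algebra_simps)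
    finally show ?thesis .
  qed
  define s :: "complex poly poly fract" where "s = (- 1) ^ plen lam"
  have ss: "s * s = 1" "fract_deriv s = 0"
    unfolding s_def by (simp_all add: hermite.D_power_const hermite.D_uminus flip: power_mult_distrib)
  have ex: "hermite.exact (s * scl (mprod m) * (to_fract (lhermite n) * (s * to_fract (T m)) -
      (2 * to_fract vary) ^ plen lam * (scl (mprod n) * exc_hermite lam n) * (to_fract \<sigma> * exc_hermite lam m)))"
    if "m \<in> Jset lam" "n \<in> Jset lam" for m n
  proof (rule hermite.exact_cmult)
    show "fract_deriv (s * scl (mprod m)) = 0" by (simp add: hermite.D_mult ss)
  qed (use adj[OF that(2), of "to_fract \<sigma> * exc_hermite lam m"] in \<open>simp only: BT[OF that(1)] s_def\<close>)
  \<comment> \<open>Both adjunction identities contain the same rational product, with the same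
    factor once they are scaled by \<open>mprod m\<close> and \<open>mprod n\<close>. It cancels in
    the difference.\<close>
  have "s * scl (mprod m) * (to_fract (lhermite n) * (s * to_fract (T m)) -
      (2 * to_fract vary) ^ plen lam * (scl (mprod n) * exc_hermite lam n) * (to_fract \<sigma> * exc_hermite lam m))
    - s * scl (mprod n) * (to_fract (lhermite m) * (s * to_fract (T n)) -
      (2 * to_fract vary) ^ plen lam * (scl (mprod m) * exc_hermite lam m) * (to_fract \<sigma> * exc_hermite lam n))
    = (s * s) * (scl (mprod m) * to_fract (lhermite n * T m) - scl (mprod n) * to_fract (lhermite m * T n))"
    by (simp add: algebra_simps)
  also have "\<dots> = to_fract (Polynomial.smult [:mprod m:] (lhermite n * T m) - Polynomial.smult [:mprod n:] (lhermite m * T n))"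
    unfolding ss(1) by (simp add: scl_mult_to_fract del: to_fract_mult)
  finally have "hermite.exact (to_fract (Polynomial.smult [:mprod m:] (lhermite n * T m)
      - Polynomial.smult [:mprod n:] (lhermite m * T n)))"
    using hermite.exact_diff[OF ex[OF m n] ex[OF n m]] by simp
  then have "gauss (Polynomial.smult [:mprod m:] (lhermite n * T m) - Polynomial.smult [:mprod n:] (lhermite m * T n)) = 0"
    unfolding hermite.exact_def using gauss_eq_0_of_fract_exact by blast
  then have *: "[:mprod m:] * gauss (lhermite n * T m) = [:mprod n:] * gauss (lhermite m * T n)"
    by (simp only: gauss_diff gauss_smult right_minus_eq)
  \<comment> \<open>Orthogonality isolates the single coefficient \<open>a m n\<close> together with
    the norm.\<close>
  have gT: "gauss (lhermite n * T m) = a m n * ((- 2 * [:0, 1:]) ^ nat (n + int (plen lam)) * fact (nat (n + int (plen lam))))"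
    if "n \<in> Jset lam" for m n
  proof -
    have "gauss (lhermite n * T m) = (\<Sum>j\<in>S m. a m j * gauss (lhermite n * lhermite j))"
      by (simp add: T_def sum_distrib_left gauss_sum gauss_smult)
    also have "\<dots> = (\<Sum>j\<in>S m. if j = n then a m n * gauss (lhermite n * lhermite n) else 0)"
    proof (intro sum.cong refl)
      fix j assume "j \<in> S m"
      then have "j \<in> Jset lam" using S(2) by blast
      then show "a m j * gauss (lhermite n * lhermite j) =
          (if j = n then a m n * gauss (lhermite n * lhermite n) else 0)"
        using that by (auto simp: lhermite_def gauss_hermite Jset_iff)
    qed
    also have "\<dots> = a m n * gauss (lhermite n * lhermite n)"
      using S(1)[of m] S(3)[where m = m and n = n] by auto
    finally show ?thesis unfolding lhermite_def gauss_hermite by simp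
  qed
  show ?thesis
    using * unfolding gT[OF m] gT[OF n] by (simp add: mult.assoc)
qed

text \<open>B carries a relation among the R_n to the same relation among Hermite polynomials, and
  pairing with one of them recovers its coefficient because the norms are nonzero.\<close>

lemma exc_hermite_independent:
  assumes S: "finite S" "S \<subseteq> Jset lam"
    and sum: "(\<Sum>n\<in>S. cst (b n) * exc_hermite lam n) = 0" and n: "n \<in> S"
  shows "b n = 0"
proof -
  obtain B where BR: "\<And>m. m \<in> Jset lam \<Longrightarrow> B (exc_hermite lam m) = (- 1) ^ plen lam * to_fract (lhermite m)"
    and Blin: "\<And>a g h. fract_deriv a = 0 \<Longrightarrow> B (a * g + h) = a * B g + B h"
    and "\<And>m g. m \<in> Jset lam \<Longrightarrow> hermite.exact (to_fract (lhermite m) * B g -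
      (2 * to_fract vary) ^ plen lam * (scl (mprod m) * exc_hermite lam m) * g)"
    and "\<And>i. i \<in> {1..plen lam} \<Longrightarrow>
      wronskian pderiv (hermites lam @ [hermite (kpart lam i)]) = 0"
    by (rule adjoint_darboux) (rule that, assumption+)
  have B0: "B 0 = 0" using Blin[of 1 0 0] by simp
  have Bsum: "B (\<Sum>i\<in>F. cst (f i) * g i) = (\<Sum>i\<in>F. cst (f i) * B (g i))" if "finite F" for F f g
    using that by (induction F) (simp_all add: B0 Blin)
  define T where "T = (\<Sum>n\<in>S. Polynomial.smult (b n) (lhermite n))"
  have "0 = B (\<Sum>n\<in>S. cst (b n) * exc_hermite lam n)"
    unfolding sum B0 ..
  also have "\<dots> = (\<Sum>n\<in>S. cst (b n) * ((- 1) ^ plen lam * to_fract (lhermite n)))"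
    unfolding Bsum[OF S(1)] using S(2) BR by (intro sum.cong) auto
  also have "\<dots> = (- 1) ^ plen lam * to_fract T"
    unfolding T_def to_fract.hom_sum sum_distrib_left
    by (intro sum.cong) (simp_all add: cst_mult_to_fract[symmetric] algebra_simps)
  finally have "T = 0" by simp
  then have "0 = gauss (lhermite n * T)" by simp
  also have "\<dots> = (\<Sum>j\<in>S. b j * gauss (lhermite n * lhermite j))"
    by (simp add: T_def sum_distrib_left gauss_sum gauss_smult)
  also have "\<dots> = (\<Sum>j\<in>S. if j = n then b n * gauss (lhermite n * lhermite n) else 0)"
  proof (intro sum.cong refl)
    fix j assume "j \<in> S"
    then have "j \<in> Jset lam" "n \<in> Jset lam" using S n by auto
    then show "b j * gauss (lhermite n * lhermite j) =
        (if j = n then b n * gauss (lhermite n * lhermite n) else 0)"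
      by (auto simp: lhermite_def gauss_hermite Jset_iff)
  qed
  also have "\<dots> = b n * gauss (lhermite n * lhermite n)" using S n by simp
  finally show ?thesis unfolding lhermite_def gauss_hermite by simp
qed

end

section \<open>Weighted homogeneity\<close>

text \<open>Integer degrees allow repeated differentiation and the degree count of a Wronskian
  without truncated subtraction.\<close>

definition homog :: "int \<Rightarrow> complex poly poly \<Rightarrow> bool" where
  "homog d p \<longleftrightarrow> (\<forall>i j. coeff (coeff p i) j \<noteq> 0 \<longrightarrow> int i + 2 * int j = d)"

lemma homog_0 [simp]: "homog d 0"
  by (simp add: homog_def)

lemma homog_add: "homog d p \<Longrightarrow> homog d q \<Longrightarrow> homog d (p + q)"
  unfolding homog_def by (metis add.right_neutral coeff_add)

lemma homog_diff: "homog d p \<Longrightarrow> homog d q \<Longrightarrow> homog d (p - q)"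
  unfolding homog_def by (metis diff_0_right coeff_diff)

lemma homog_sum: "(\<And>i. i \<in> S \<Longrightarrow> homog d (f i)) \<Longrightarrow> homog d (\<Sum>i\<in>S. f i)"
  by (induction S rule: infinite_finite_induct) (auto intro: homog_add)

lemma homog_mult:
  assumes "homog d p" "homog e q"
  shows "homog (d + e) (p * q)"
  unfolding homog_def
proof (intro allI impI)
  fix i j assume "coeff (coeff (p * q) i) j \<noteq> 0"
  then have "(\<Sum>s\<le>i. \<Sum>t\<le>j. coeff (coeff p s) t * coeff (coeff q (i - s)) (j - t)) \<noteq> 0"
    by (simp add: coeff_mult coeff_sum)
  then obtain s where s: "s \<le> i" "(\<Sum>t\<le>j. coeff (coeff p s) t * coeff (coeff q (i - s)) (j - t)) \<noteq> 0"
    by (meson atMost_iff sum.not_neutral_contains_not_neutral)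
  then obtain t where t: "t \<le> j" "coeff (coeff p s) t * coeff (coeff q (i - s)) (j - t) \<noteq> 0"
    by (meson atMost_iff sum.not_neutral_contains_not_neutral)
  then have "coeff (coeff p s) t \<noteq> 0" "coeff (coeff q (i - s)) (j - t) \<noteq> 0" by auto
  then have "int s + 2 * int t = d" "int (i - s) + 2 * int (j - t) = e"
    using assms unfolding homog_def by blast+
  then show "int i + 2 * int j = d + e" using s t by (simp add: of_nat_diff)
qed

lemma homog_const: "homog 0 [:[:c:]:]"
  by (auto simp: homog_def coeff_pCons split: nat.splits)

lemma homog_prod: "(\<And>i. i \<in> S \<Longrightarrow> homog (d i) (f i)) \<Longrightarrow> homog (\<Sum>i\<in>S. d i) (\<Prod>i\<in>S. f i)"
proof (induction S rule: infinite_finite_induct)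
  case (insert i S)
  then show ?case by (auto intro: homog_mult)
qed (use homog_const[of 1] in \<open>simp_all add: one_pCons\<close>)

lemma homog_pderiv:
  assumes "homog d p"
  shows "homog (d - 1) (pderiv p)"
  unfolding homog_def
proof (intro allI impI)
  fix i j assume "coeff (coeff (pderiv p) i) j \<noteq> 0"
  moreover have "coeff (coeff (pderiv p) i) j = of_nat (Suc i) * coeff (coeff p (Suc i)) j"
    unfolding coeff_pderiv of_nat_poly by simp
  ultimately have "coeff (coeff p (Suc i)) j \<noteq> 0" by auto
  then show "int i + 2 * int j = d - 1" using assms by (force simp: homog_def)
qed

lemma homog_higher_pderiv: "homog d p \<Longrightarrow> homog (d - int i) ((pderiv ^^ i) p)"
proof (induction i)
  case (Suc i)
  then show ?case using homog_pderiv[of "d - int i"] by (simp add: algebra_simps)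
qed simp

lemma homog_hermite: "homog (int n) (hermite n)"
proof (induction n)
  case 0
  then show ?case using homog_const[of 1] by (simp add: hermite_0 one_pCons)
next
  case (Suc n)
  have x: "homog 1 varx" and y: "homog 2 (2 * vary)"
    by (auto simp: homog_def varx_def vary_def coeff_pCons numeral_poly one_pCons split: nat.splits)
  have "homog (1 + int n) (varx * hermite n)" by (rule homog_mult[OF x Suc.IH])
  moreover have "homog (2 + (int n - 1)) (2 * vary * pderiv (hermite n))"
    by (rule homog_mult[OF y homog_pderiv[OF Suc.IH]])
  ultimately show ?case using homog_add[of "1 + int n"] by (simp add: hermite_rec)
qed

text \<open>In the Leibniz formula a permutation only redistributes the degrees of the entries over
  the rows, so every term has the same total degree.\<close>

lemma homog_wronskian:
  assumes "\<And>j. j < length fs \<Longrightarrow> homog (d j) (fs ! j)"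
  shows "homog (\<Sum>j<length fs. d j - int j) (wronskian pderiv fs)"
proof -
  define n where "n = length fs"
  define M where "M = mat n n (\<lambda>(i, j). (pderiv ^^ i) (fs ! j))"
  have homog_term: "homog (\<Sum>j<n. d j - int j) (signof p * (\<Prod>i = 0..<n. M $$ (i, p i)))"
    if p: "p permutes {0..<n}" for p
  proof -
    have "homog (\<Sum>i=0..<n. d (p i) - int i) (\<Prod>i = 0..<n. M $$ (i, p i))"
    proof (rule homog_prod)
      fix i assume i: "i \<in> {0..<n}"
      then have "p i < n" using permutes_in_image[OF p, of i] by simp
      then show "homog (d (p i) - int i) (M $$ (i, p i))"
        using i assms by (simp add: M_def n_def homog_higher_pderiv)
    qed
    moreover have "(\<Sum>i=0..<n. d (p i)) = (\<Sum>i=0..<n. d i)"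
      using sum.permute[OF p, of d] by (simp add: o_def)
    ultimately have "homog (0 + (\<Sum>j<n. d j - int j)) ([:[:signof p:]:] * (\<Prod>i = 0..<n. M $$ (i, p i)))"
      by (intro homog_mult homog_const) (simp add: sum_subtractf atLeast0LessThan)
    moreover have "[:[:signof p:]:] = (signof p :: complex poly poly)"
      by (simp add: sign_def one_pCons)
    ultimately show ?thesis by simp
  qed
  have "wronskian pderiv fs = det M" by (simp add: wronskian_def M_def n_def)
  also have "\<dots> = (\<Sum>p | p permutes {0..<n}. signof p * (\<Prod>i = 0..<n. M $$ (i, p i)))"
    by (simp add: det_def M_def)
  finally show ?thesis unfolding n_def[symmetric]
    by (simp only:) (rule homog_sum, simp add: homog_term)
qed

text \<open>Expansion along the last column: the minors depend on \<open>fs\<close> alone, so the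
  Wronskian is a fixed linear expression in the derivatives of \<open>f\<close>.\<close>

lemma wronskian_snoc_expand:
  "wronskian D (fs @ [f]) = (\<Sum>i<Suc (length fs). (D ^^ i) f * ((- 1) ^ (i + length fs) *
     det (mat (length fs) (length fs) (\<lambda>(r, c). (D ^^ (if r < i then r else Suc r)) (fs ! c)))))"
proof -
  define n where "n = length fs"
  define M where "M = mat (Suc n) (Suc n) (\<lambda>(i, j). (D ^^ i) ((fs @ [f]) ! j))"
  have M: "M \<in> carrier_mat (Suc n) (Suc n)" by (simp add: M_def)
  have "wronskian D (fs @ [f]) = det M" by (simp add: wronskian_def M_def n_def)
  also have "\<dots> = (\<Sum>i<Suc n. M $$ (i, n) * cofactor M i n)"
    by (rule laplace_expansion_column[OF M]) simp
  also have "\<dots> = (\<Sum>i<Suc n. (D ^^ i) f * ((- 1) ^ (i + n) *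
     det (mat n n (\<lambda>(r, c). (D ^^ (if r < i then r else Suc r)) (fs ! c)))))"
  proof (intro sum.cong refl)
    fix i assume i: "i \<in> {..<Suc n}"
    have "mat_delete M i n = mat n n (\<lambda>(r, c). (D ^^ (if r < i then r else Suc r)) (fs ! c))"
      by (rule eq_matI) (auto simp: mat_delete_def M_def nth_append n_def)
    moreover have "M $$ (i, n) = (D ^^ i) f" using i by (simp add: M_def n_def nth_append)
    ultimately show "M $$ (i, n) * cofactor M i n = (D ^^ i) f * ((- 1) ^ (i + n) *
       det (mat n n (\<lambda>(r, c). (D ^^ (if r < i then r else Suc r)) (fs ! c))))"
      by (simp add: cofactor_def)
  qed
  finally show ?thesis by (simp add: n_def)
qed

interpretation fps_const: comm_ring_hom fps_const
  by unfold_locales auto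

lemma fps_dx_funpow_const: "(fps_dx ^^ i) (fps_const p) = fps_const ((pderiv ^^ i) p)"
proof (induction i)
  case (Suc i)
  then show ?case by (auto simp: fps_dx_def fps_eq_iff)
qed simp

lemma fps_dx_funpow_nth: "fps_nth ((fps_dx ^^ i) F) n = (pderiv ^^ i) (fps_nth F n)"
  by (induction i) (auto simp: fps_dx_def)

text \<open>All columns but the last are constant in z, so taking a coefficient of the generating
  function commutes with the Wronskian.\<close>

lemma fps_nth_wronskian:
  "fps_nth (wronskian fps_dx (map fps_const fs @ [F])) n = wronskian pderiv (fs @ [fps_nth F n])"
proof -
  define N where "N i = mat (length fs) (length fs)
    (\<lambda>(r, c). (pderiv ^^ (if r < i then r else Suc r)) (fs ! c))" for i
  have "mat (length fs) (length fs) (\<lambda>(r, c). (fps_dx ^^ (if r < i then r else Suc r)) (map fps_const fs ! c))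
      = map_mat fps_const (N i)" for i
    by (rule eq_matI) (simp_all add: N_def fps_dx_funpow_const del: funpow.simps)
  then have "wronskian fps_dx (map fps_const fs @ [F]) = (\<Sum>i<Suc (length fs).
      (fps_dx ^^ i) F * fps_const ((- 1) ^ (i + length fs) * det (N i)))"
    unfolding wronskian_snoc_expand length_map fps_const.hom_mult fps_const.hom_power
    by (simp only: fps_const.hom_det fps_const.hom_uminus fps_const.hom_one)
  then show ?thesis
    unfolding wronskian_snoc_expand N_def[symmetric]
    by (simp only: fps_sum_nth fps_mult_right_const_nth fps_dx_funpow_nth)
qed

lemma wronskian_snoc_smult:
  "wronskian pderiv (fs @ [Polynomial.smult c f]) = Polynomial.smult c (wronskian pderiv (fs @ [f]))"
  for f :: "'a::idom poly"
  unfolding wronskian_snoc_expand higher_pderiv_smult mult_smult_left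
  by (rule poly_eqI) (simp add: coeff_sum sum_distrib_left del: sum.lessThan_Suc)

section \<open>Coefficients of a differential operator applied to a Laurent series\<close>

lemma fls_nth_higher_deriv:
  "fls_nth ((fls_deriv ^^ i) f) n =
     poly (ffact_poly i) (of_int (n + int i)) * fls_nth (f :: 'a::comm_ring_1 fls) (n + int i)"
proof (induction i arbitrary: n)
  case 0
  then show ?case by (simp add: ffact_poly_def)
next
  case (Suc i)
  have "poly (ffact_poly (Suc i)) (of_int (n + int (Suc i))) =
      (of_int (n + 1) * poly (ffact_poly i) (of_int (n + int (Suc i))) :: 'a)"
    by (simp add: ffact_poly_def algebra_simps)
  then show ?case using Suc[of "n + 1"] by (simp add: algebra_simps)
qed

lemma cst_ffact_poly: "poly (ffact_poly i) (of_int x) = cst (poly (ffact_poly i) (of_int x))"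
  by (simp add: ffact_poly_def poly_prod cst.hom_prod cst.hom_minus cst.hom_of_int cst.hom_of_nat
      hom_distribs)

lemma fls_nth_diffop_apply:
  "fls_nth (diffop_apply cst \<pi> f) m = (\<Sum>d\<in>Poly_Mapping.keys (natural \<pi>).
     cst (poly (Poly_Mapping.lookup (natural \<pi>) d) (of_int (m - d))) * fls_nth f (m - d))"
proof -
  define I where "I = (SIGMA k:Poly_Mapping.keys \<pi>. {..degree (Poly_Mapping.lookup \<pi> k)})"
  define g where "g = (\<lambda>(k, i). k - int i)"
  define t where "t = (\<lambda>(k, i). Polynomial.smult (coeff (Poly_Mapping.lookup \<pi> k) i) (ffact_poly i))"
  have fin: "finite I" by (simp add: I_def)
  have nat: "Poly_Mapping.lookup (natural \<pi>) d = (\<Sum>x\<in>I. t x when g x = d)" for d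
    unfolding natural_def lookup_sum_apply I_def t_def g_def
    by (simp add: sum.Sigma lookup_single split_def)
  have shift: "m - (k - int i) = m - k + int i" for k i by simp
  \<comment> \<open>Several monomials z^k D^i share the shift k - i and may cancel in
    \<open>natural\<close>, so its keys can be fewer than the shifts; the union serves both
    sums.\<close>
  define K where "K = g ` I \<union> Poly_Mapping.keys (natural \<pi>)"
  have "(\<Sum>d\<in>Poly_Mapping.keys (natural \<pi>).
      cst (poly (Poly_Mapping.lookup (natural \<pi>) d) (of_int (m - d))) * fls_nth f (m - d)) =
    (\<Sum>d\<in>K. cst (poly (Poly_Mapping.lookup (natural \<pi>) d) (of_int (m - d))) * fls_nth f (m - d))"
    by (rule sum.mono_neutral_left) (auto simp: K_def fin in_keys_iff)
  also have "\<dots> = (\<Sum>d\<in>K. \<Sum>x\<in>I. if d = g x then cst (poly (t x) (of_int (m - g x))) * fls_nth f (m - g x) else 0)"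
    unfolding nat poly_sum cst.hom_sum sum_distrib_right
    by (intro sum.cong refl) (auto simp: when_def)
  also have "\<dots> = (\<Sum>x\<in>I. \<Sum>d\<in>K. if d = g x then cst (poly (t x) (of_int (m - g x))) * fls_nth f (m - g x) else 0)"
    by (rule sum.swap)
  also have "\<dots> = (\<Sum>x\<in>I. cst (poly (t x) (of_int (m - g x))) * fls_nth f (m - g x))"
    by (intro sum.cong refl) (auto simp: K_def fin)
  also have "\<dots> = fls_nth (diffop_apply cst \<pi> f) m"
    unfolding diffop_apply_def fls_nth_sum fls_nth_const_intpow_mult fls_nth_higher_deriv I_def
    by (subst sum.Sigma) (auto simp only: t_def g_def prod.case poly_smult cst.hom_mult
      cst_ffact_poly mult.assoc shift finite_keys finite_atMost intro!: sum.cong)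
  finally show ?thesis ..
qed

section \<open>The recurrence relation\<close>

lemma fact_poly_const: "(fact n :: 'a::{idom,ring_char_0} poly) = [:fact n:]"
  using of_nat_poly[of "fact n", where ?'a = 'a] by (simp only: of_nat_fact)

context partition begin

text \<open>The c_m in the expansion of \<Psi>: the factorial comes from the exponential generating
  function, and \<open>mprod\<close> undoes the normalisation of R_m.\<close>

definition psi_coeff :: "int \<Rightarrow> complex" where
  "psi_coeff m = mprod m / fact (nat (m + int (plen lam)))"

lemma psi_coeff_nonzero: "m \<in> Jset lam \<Longrightarrow> psi_coeff m \<noteq> 0"
  by (simp add: psi_coeff_def mprod_nonzero)

lemma wronskian_kpart: "i \<in> {1..plen lam} \<Longrightarrow> wronskian pderiv (hermites lam @ [hermite (kpart lam i)]) = 0"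
  by (rule adjoint_darboux)

definition numerator :: "int \<Rightarrow> complex poly poly" where
  "numerator m = wronskian pderiv (hermites lam @ [lhermite m])"

definition denominator :: "complex poly poly" where
  "denominator = wronskian pderiv (hermites lam)"

lemma exc_hermite_mult_denominator:
  "m \<in> Jset lam \<Longrightarrow> to_fract denominator * (scl (mprod m) * exc_hermite lam m) = to_fract (numerator m)"
proof -
  assume m: "m \<in> Jset lam"
  have "exc_hermite lam m = scl (1 / mprod m) * (to_fract (numerator m) / to_fract denominator)"
    by (simp add: exc_hermite_def mprod_def Fract_conv_to_fract numerator_def lhermite_def
        denominator_def scl_def cst_def)
  moreover have "scl (mprod m) * scl (1 / mprod m) = 1"
    using mprod_nonzero[OF m] by (simp flip: scl.hom_mult)
  ultimately have "scl (mprod m) * exc_hermite lam m = to_fract (numerator m) / to_fract denominator"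
    by (metis mult.assoc mult_1)
  then show ?thesis using wronskian_hermites_nonzero by (simp add: denominator_def)
qed

text \<open>The coefficient of z^m is a Wronskian whose last entry is H_(m+l) up to a factorial.
  Outside J, either m < -l, where the series has no term, or m is one of the m_i, and the last entry
  is already among the seeds.\<close>

lemma fls_nth_Psi:
  "fls_nth (Psi lam) m = (if m \<in> Jset lam then scl (psi_coeff m) * exc_hermite lam m else 0)"
proof -
  define n where "n = nat (m + int (plen lam))"
  have Psi: "fls_nth (Psi lam) m = (if m + int (plen lam) < 0 then 0 else
      Fract (wronskian pderiv (hermites lam @ [fps_nth exp_xyz n])) denominator)"
    unfolding Psi_def fls_X_intpow_times_conv_shift(1)
    by (simp add: fps_nth_wronskian n_def denominator_def)
  have "fps_nth exp_xyz n = Polynomial.smult [:1 / fact n:] (hermite n)"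
  proof -
    have "(fact n :: complex poly poly) = [:[:fact n:]:]"
      by (simp only: fact_poly_const)
    then show ?thesis by (simp add: hermite_def flip: one_pCons)
  qed
  then have w: "wronskian pderiv (hermites lam @ [fps_nth exp_xyz n]) =
      Polynomial.smult [:1 / fact n:] (numerator m)"
    by (simp add: wronskian_snoc_smult numerator_def lhermite_def n_def)
  show ?thesis
  proof (cases "m \<in> Jset lam")
    case True
    then have "m + int (plen lam) \<ge> 0" by (auto simp: Jset_iff)
    moreover have "to_fract (numerator m) / to_fract denominator = scl (mprod m) * exc_hermite lam m"
      using exc_hermite_mult_denominator[OF True] wronskian_hermites_nonzero
      by (simp add: field_simps denominator_def)
    moreover have "scl (psi_coeff m) = scl (1 / fact n) * scl (mprod m)"
      by (simp add: psi_coeff_def n_def flip: scl.hom_mult)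
    ultimately show ?thesis using True
      by (simp add: Psi w Fract_conv_to_fract scl_mult_to_fract[symmetric] mult.assoc flip: times_divide_eq_right)
  next
    case False
    show ?thesis
    proof (cases "m + int (plen lam) < 0")
      case nonneg: False
      then obtain i where i: "i \<in> {1..plen lam}" "m = mpart lam i"
        using False by (auto simp: Jset_iff)
      then have "n = kpart lam i" by (simp add: n_def kpart_def)
      then have "numerator m = 0" using wronskian_kpart[OF i(1)]
        by (simp add: numerator_def lhermite_def n_def)
      then show ?thesis using False by (simp add: Psi w Fract_conv_to_fract)
    qed (use False in \<open>simp add: Psi\<close>)
  qed
qed

definition rec_set :: "(int \<Rightarrow>\<^sub>0 complex poly poly) \<Rightarrow> int \<Rightarrow> int set" where
  "rec_set \<pi> m = {n \<in> Jset lam. m - n \<in> Poly_Mapping.keys (natural \<pi>)}"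

text \<open>The coefficient of R_n in \<sigma> R_m, found by comparing z^m in the eigenvalue
  equation of \<Psi> and dividing by c_m: the power z^n reaches z^m through the shift m - n, with
  the symbol evaluated at n.\<close>

definition rec_coeff :: "(int \<Rightarrow>\<^sub>0 complex poly poly) \<Rightarrow> int \<Rightarrow> int \<Rightarrow> complex poly" where
  "rec_coeff \<pi> m n = (if n \<in> rec_set \<pi> m then Polynomial.smult (psi_coeff n / psi_coeff m)
     (poly (Poly_Mapping.lookup (natural \<pi>) (m - n)) (of_int n)) else 0)"

lemma finite_rec_set: "finite (rec_set \<pi> m)"
proof -
  have "rec_set \<pi> m \<subseteq> (\<lambda>d. m - d) ` Poly_Mapping.keys (natural \<pi>)"
  proof
    fix n assume "n \<in> rec_set \<pi> m"
    then show "n \<in> (\<lambda>d. m - d) ` Poly_Mapping.keys (natural \<pi>)"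
      by (intro image_eqI[of _ _ "m - n"]) (auto simp: rec_set_def)
  qed
  then show ?thesis by (rule finite_subset) simp
qed

lemma rec_set_subset: "rec_set \<pi> m \<subseteq> Jset lam"
  by (auto simp: rec_set_def)

lemma rec_coeff_eq:
  assumes "n \<in> Jset lam"
  shows "rec_coeff \<pi> m n = Polynomial.smult (psi_coeff n / psi_coeff m)
     (poly (Poly_Mapping.lookup (natural \<pi>) (m - n)) (of_int n))"
  using assms by (auto simp: rec_coeff_def rec_set_def in_keys_iff)

lemma sharp_recurrence:
  assumes sharp: "is_sharp lam \<sigma> \<pi>" and m: "m \<in> Jset lam"
  shows "to_fract \<sigma> * exc_hermite lam m = (\<Sum>n\<in>rec_set \<pi> m. cst (rec_coeff \<pi> m n) * exc_hermite lam n)"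
proof -
  define f where "f n = cst (poly (Poly_Mapping.lookup (natural \<pi>) (m - n)) (of_int n)) * fls_nth (Psi lam) n" for n
  have "(\<lambda>c. to_fract [:c:]) = cst" by (simp add: fun_eq_iff cst_def)
  then have "diffop_apply cst \<pi> (Psi lam) = fls_const (to_fract \<sigma>) * Psi lam"
    using sharp by (simp add: is_sharp_def)
  then have "to_fract \<sigma> * fls_nth (Psi lam) m = fls_nth (diffop_apply cst \<pi> (Psi lam)) m" by simp
  also have "\<dots> = (\<Sum>d\<in>Poly_Mapping.keys (natural \<pi>). f (m - d))"
    unfolding fls_nth_diffop_apply f_def by simp
  also have "\<dots> = (\<Sum>n\<in>(\<lambda>d. m - d) ` Poly_Mapping.keys (natural \<pi>). f n)"
    by (subst sum.reindex) (auto intro: inj_onI)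
  also have "\<dots> = (\<Sum>n\<in>rec_set \<pi> m. f n)"
  proof (rule sum.mono_neutral_right)
    show "rec_set \<pi> m \<subseteq> (\<lambda>d. m - d) ` Poly_Mapping.keys (natural \<pi>)"
    proof
      fix n assume "n \<in> rec_set \<pi> m"
      then show "n \<in> (\<lambda>d. m - d) ` Poly_Mapping.keys (natural \<pi>)"
        by (intro image_eqI[of _ _ "m - n"]) (auto simp: rec_set_def)
    qed
    show "\<forall>n\<in>(\<lambda>d. m - d) ` Poly_Mapping.keys (natural \<pi>) - rec_set \<pi> m. f n = 0"
      by (auto simp: f_def fls_nth_Psi rec_set_def)
  qed simp
  finally have eq: "to_fract \<sigma> * (scl (psi_coeff m) * exc_hermite lam m) = (\<Sum>n\<in>rec_set \<pi> m. f n)"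
    using m by (simp add: fls_nth_Psi)
  have inv: "scl (1 / psi_coeff m) * scl (psi_coeff m) = 1"
    using psi_coeff_nonzero[OF m] by (simp flip: scl.hom_mult)
  have "to_fract \<sigma> * exc_hermite lam m =
      (scl (1 / psi_coeff m) * scl (psi_coeff m)) * (to_fract \<sigma> * exc_hermite lam m)"
    unfolding inv by simp
  also have "\<dots> = scl (1 / psi_coeff m) * (\<Sum>n\<in>rec_set \<pi> m. f n)"
    unfolding eq[symmetric] by (simp only: mult_ac)
  also have "\<dots> = (\<Sum>n\<in>rec_set \<pi> m. cst (rec_coeff \<pi> m n) * exc_hermite lam n)"
    unfolding sum_distrib_left
  proof (intro sum.cong refl)
    fix n assume n: "n \<in> rec_set \<pi> m"
    then have J: "n \<in> Jset lam" by (simp add: rec_set_def)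
    have "cst (rec_coeff \<pi> m n) = scl (1 / psi_coeff m) * scl (psi_coeff n) *
        cst (poly (Poly_Mapping.lookup (natural \<pi>) (m - n)) (of_int n))"
      unfolding scl.hom_mult[symmetric] scl_mult_cst using n by (simp add: rec_coeff_def)
    then show "scl (1 / psi_coeff m) * f n = cst (rec_coeff \<pi> m n) * exc_hermite lam n"
      using J by (simp add: f_def fls_nth_Psi mult_ac)
  qed
  finally show ?thesis .
qed

text \<open>Only the uniformity of \<open>d\<close> matters: passing from m to n changes the weight
  by n - m.\<close>

lemma homog_numerator: "\<exists>d. \<forall>m\<in>Jset lam. homog (d + m) (numerator m)"
proof -
  define ks where "ks = khermites"
  define d where "d = (\<Sum>j<length ks. int (ks ! j) - int j) - int (length ks) + int (plen lam)"
  have "homog (d + m) (numerator m)" if "m \<in> Jset lam" for m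
  proof -
    define k where "k = nat (m + int (plen lam))"
    have k: "int k = m + int (plen lam)" using that by (auto simp: k_def Jset_iff)
    define ks' where "ks' = ks @ [k]"
    have num: "numerator m = wronskian pderiv (map hermite ks')"
      by (simp add: numerator_def lhermite_def ks'_def ks_def hermites_eq k_def)
    have "homog (\<Sum>j<length (map hermite ks'). int (ks' ! j) - int j) (numerator m)"
      unfolding num by (rule homog_wronskian) (simp add: homog_hermite)
    moreover have "(\<Sum>j<length (map hermite ks'). int (ks' ! j) - int j) = d + m"
      by (simp add: ks'_def d_def nth_append k)
    ultimately show ?thesis by simp
  qed
  then show ?thesis by blast
qed

text \<open>Weights are compared after multiplication by the common denominator. The parts of the
  coefficients of the wrong weight must satisfy a relation among the R_n, and independence kills
  them.\<close>

lemma recurrence_homogeneous: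
  assumes S: "finite S" "S \<subseteq> Jset lam" and \<sigma>: "homog q \<sigma>" and m: "m \<in> Jset lam"
    and rec: "to_fract \<sigma> * exc_hermite lam m = (\<Sum>n\<in>S. cst (a n) * exc_hermite lam n)"
    and n: "n \<in> S" and nz: "coeff (a n) j \<noteq> 0"
  shows "q + m = n + 2 * int j"
proof (rule ccontr)
  assume neq: "q + m \<noteq> n + 2 * int j"
  obtain d where d: "\<And>m. m \<in> Jset lam \<Longrightarrow> homog (d + m) (numerator m)"
    using homog_numerator by blast
  define w where "w n = Polynomial.smult [:1 / mprod n:] (numerator n)" for n
  have homog_smult: "homog e (Polynomial.smult [:c:] p)" if "homog e p" for e c p
    using homog_mult[OF homog_const[of c] that] by simp
  have w: "homog (d + n) (w n)" if "n \<in> Jset lam" for n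
    unfolding w_def by (intro homog_smult d that)
  have Rw: "to_fract denominator * exc_hermite lam n = to_fract (w n)" if "n \<in> Jset lam" for n
  proof -
    have "scl (1 / mprod n) * scl (mprod n) = 1"
      using mprod_nonzero[OF that] by (simp flip: scl.hom_mult)
    then have "to_fract denominator * exc_hermite lam n =
        scl (1 / mprod n) * (to_fract denominator * (scl (mprod n) * exc_hermite lam n))"
      by (simp add: mult_ac flip: mult.assoc[of "scl (1 / mprod n)"])
    then show ?thesis
      unfolding exc_hermite_mult_denominator[OF that] by (simp add: w_def scl_mult_to_fract)
  qed
  have "to_fract (\<sigma> * w m) = to_fract denominator * (to_fract \<sigma> * exc_hermite lam m)"
    unfolding to_fract_mult Rw[OF m, symmetric] by (simp only: mult_ac)
  also have "\<dots> = (\<Sum>n\<in>S. cst (a n) * to_fract (w n))"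
    unfolding rec sum_distrib_left using Rw S(2) by (intro sum.cong refl) (auto simp: mult.left_commute)
  also have "\<dots> = to_fract (\<Sum>n\<in>S. Polynomial.smult (a n) (w n))"
    unfolding to_fract.hom_sum cst_mult_to_fract ..
  finally have rec_w: "\<sigma> * w m = (\<Sum>n\<in>S. Polynomial.smult (a n) (w n))"
    using to_fract.eq_iff by blast
  \<comment> \<open>The monomial of \<open>a n\<close> of weight q + m - n, the only one the claim
    permits.\<close>
  define a0 where "a0 n = (if even (q + m - n) \<and> n \<le> q + m
    then Polynomial.monom (coeff (a n) (nat ((q + m - n) div 2))) (nat ((q + m - n) div 2)) else 0)" for n
  have a0: "coeff (a0 n) s = (if q + m = n + 2 * int s then coeff (a n) s else 0)" for n s
  proof (cases "q + m = n + 2 * int s")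
    case False
    have "nat ((q + m - n) div 2) \<noteq> s" if ev: "even (q + m - n)" and le: "n \<le> q + m"
    proof -
      obtain c where c: "q + m - n = 2 * c" using ev by (rule evenE)
      then have "(q + m - n) div 2 = c" by simp
      then show ?thesis using le False c by linarith
    qed
    with False show ?thesis by (simp add: a0_def)
  qed (simp add: a0_def)
  define b where "b n = a n - a0 n" for n
  define Z where "Z = (\<Sum>n\<in>S. Polynomial.smult (b n) (w n))"
  \<comment> \<open>Z is homogeneous as a difference of two homogeneous polynomials, yet it has no
    coefficient of that weight, because each \<open>b n\<close> lacks the matching power of y. Hence
    Z = 0.\<close>
  have "Z = \<sigma> * w m - (\<Sum>n\<in>S. Polynomial.smult (a0 n) (w n))"
    by (simp add: Z_def rec_w b_def smult_diff_left sum_subtractf)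
  also have "homog (q + (d + m)) \<dots>"
  proof (intro homog_diff homog_sum homog_mult[OF \<sigma> w[OF m]])
    fix n assume "n \<in> S"
    then have "n \<in> Jset lam" using S by auto
    moreover have "homog (q + m - n) [:a0 n:]"
      by (auto simp: homog_def coeff_pCons a0 split: nat.splits if_splits)
    ultimately show "homog (q + (d + m)) (Polynomial.smult (a0 n) (w n))"
      using homog_mult[OF _ w, of "q + m - n" "[:a0 n:]" n] by (simp add: algebra_simps)
  qed
  finally have homogZ: "homog (q + (d + m)) Z" .
  have "coeff (coeff Z i) s = 0" for i s
  proof (cases "int i + 2 * int s = q + (d + m)")
    case True
    have "coeff (coeff (w n) i) (s - t) * coeff (b n) t = 0" if "n \<in> S" "t \<le> s" for n t
    proof (rule ccontr)
      assume "\<not> ?thesis"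
      then have nz: "coeff (coeff (w n) i) (s - t) \<noteq> 0" "coeff (b n) t \<noteq> 0" by auto
      have "int i + 2 * int (s - t) = d + n"
        using w[of n] S(2) that(1) nz(1) unfolding homog_def by blast
      moreover have "q + m \<noteq> n + 2 * int t" using nz(2) by (auto simp: b_def a0)
      ultimately show False using True that by (simp add: of_nat_diff)
    qed
    note zero = this
    have "coeff (coeff Z i) s = (\<Sum>n\<in>S. \<Sum>t\<le>s. coeff (coeff (w n) i) (s - t) * coeff (b n) t)"
      by (simp add: Z_def coeff_sum coeff_mult mult.commute)
    also have "\<dots> = 0"
      by (intro sum.neutral ballI zero) auto
    finally show ?thesis .
  qed (use homogZ in \<open>auto simp: homog_def\<close>)
  then have "Z = 0" by (simp add: poly_eq_iff)
  have "(\<Sum>n\<in>S. cst (b n) * exc_hermite lam n) = 0"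
  proof -
    have "to_fract denominator * (\<Sum>n\<in>S. cst (b n) * exc_hermite lam n) =
        (\<Sum>n\<in>S. cst (b n) * to_fract (w n))"
      unfolding sum_distrib_left using Rw S(2) by (intro sum.cong refl) (auto simp: mult.left_commute)
    also have "\<dots> = to_fract Z"
      unfolding Z_def to_fract.hom_sum cst_mult_to_fract ..
    finally show ?thesis
      using \<open>Z = 0\<close> wronskian_hermites_nonzero by (simp add: denominator_def)
  qed
  from exc_hermite_independent[OF S this n] have "b n = 0" .
  then have "coeff (a n) j = coeff (a0 n) j" by (simp add: b_def)
  then show False using nz neq by (simp add: a0)
qed

end

section \<open>The symbol of a differential operator\<close>

text \<open>For a fixed shift d, the monomials z^k D^i that contribute have k = d + i; a common
  degree bound makes the sum over i independent of k.\<close>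

lemma sum_diff_eq_index:
  fixes g :: "'b::comm_ring_1 \<Rightarrow> nat \<Rightarrow> 'c::comm_monoid_add" and \<pi> :: "int \<Rightarrow>\<^sub>0 'b poly"
  assumes g: "\<And>i. g 0 i = 0" and N: "\<And>k. degree (Poly_Mapping.lookup \<pi> k) \<le> N"
  shows "(\<Sum>k\<in>Poly_Mapping.keys \<pi>. \<Sum>i\<le>degree (Poly_Mapping.lookup \<pi> k).
      if k - int i = d then g (coeff (Poly_Mapping.lookup \<pi> k) i) i else 0) =
    (\<Sum>i\<le>N. g (coeff (Poly_Mapping.lookup \<pi> (d + int i)) i) i)"
proof -
  have "(\<Sum>k\<in>Poly_Mapping.keys \<pi>. \<Sum>i\<le>degree (Poly_Mapping.lookup \<pi> k).
      if k - int i = d then g (coeff (Poly_Mapping.lookup \<pi> k) i) i else 0) =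
    (\<Sum>k\<in>Poly_Mapping.keys \<pi>. \<Sum>i\<le>N.
      if k = d + int i then g (coeff (Poly_Mapping.lookup \<pi> (d + int i)) i) i else 0)"
  proof (rule sum.cong[OF refl], rule sum.mono_neutral_cong_left)
    fix k
    show "\<forall>i\<in>{..N} - {..degree (Poly_Mapping.lookup \<pi> k)}.
        (if k = d + int i then g (coeff (Poly_Mapping.lookup \<pi> (d + int i)) i) i else 0) = 0"
      by (auto simp: coeff_eq_0 g)
  qed (use N in auto)
  also have "\<dots> = (\<Sum>i\<le>N. \<Sum>k\<in>Poly_Mapping.keys \<pi>.
      if k = d + int i then g (coeff (Poly_Mapping.lookup \<pi> (d + int i)) i) i else 0)"
    by (rule sum.swap)
  also have "\<dots> = (\<Sum>i\<le>N. g (coeff (Poly_Mapping.lookup \<pi> (d + int i)) i) i)"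
    by (intro sum.cong refl) (auto simp: in_keys_iff g)
  finally show ?thesis .
qed

lemma degree_lookup_bounded:
  obtains N where "\<And>k. degree (Poly_Mapping.lookup (\<pi> :: int \<Rightarrow>\<^sub>0 'b::zero poly) k) \<le> N"
proof
  fix k
  show "degree (Poly_Mapping.lookup \<pi> k) \<le> (\<Sum>k\<in>Poly_Mapping.keys \<pi>. degree (Poly_Mapping.lookup \<pi> k))"
  proof (cases "k \<in> Poly_Mapping.keys \<pi>")
    case True
    then show ?thesis by (intro member_le_sum) auto
  qed (simp add: in_keys_iff)
qed

lemma lookup_natural:
  assumes "\<And>k. degree (Poly_Mapping.lookup \<pi> k) \<le> N"
  shows "Poly_Mapping.lookup (natural \<pi>) d =
    (\<Sum>i\<le>N. Polynomial.smult (coeff (Poly_Mapping.lookup \<pi> (d + int i)) i) (ffact_poly i))"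
  using sum_diff_eq_index[of "\<lambda>c i. Polynomial.smult c (ffact_poly i)" \<pi> N d] assms
  by (simp add: natural_def lookup_sum_apply lookup_single when_def)

lemma ffact_poly_Suc:
  "ffact_poly (Suc i) = pCons 0 (ffact_poly i) - Polynomial.smult (of_nat i) (ffact_poly i)"
  by (simp add: ffact_poly_def mult.commute)

lemma coeff_poly_of_int:
  "coeff (poly P (of_int m)) j = poly (map_poly (\<lambda>p. coeff p j) P) (of_int m)"
  for P :: "complex poly poly"
  by (induction P) (auto simp: map_poly_pCons of_int_poly)

lemma poly_eq_0_of_large:
  assumes "\<And>n. n \<ge> n0 \<Longrightarrow> poly p (of_int n) = 0"
  shows "p = (0 :: complex poly)"
proof (rule ccontr)
  assume "p \<noteq> 0"
  then have "finite {x. poly p x = 0}" by (rule poly_roots_finite)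
  moreover have "of_int ` {n0..} \<subseteq> {x. poly p x = 0}" using assms by auto
  ultimately have "finite (of_int ` {n0..} :: complex set)" by (rule finite_subset[rotated])
  then have "finite {n0..}" by (rule finite_imageD) (auto intro: inj_onI)
  then show False by (simp add: infinite_Ici)
qed

lemma poly_eq_of_large:
  assumes "\<And>n. n \<ge> n0 \<Longrightarrow> poly p (of_int n) = poly r (of_int n)"
  shows "p = (r :: complex poly)"
  using poly_eq_0_of_large[of n0 "p - r"] assms by simp

text \<open>Triangularity: at the point r every falling factorial of order above r vanishes, and the
  one of order r does not.\<close>

lemma ffact_poly_independent:
  assumes "(\<Sum>i\<le>N. Polynomial.smult (c i) (ffact_poly i)) = (0 :: complex poly)" and "i \<le> N"
  shows "c i = 0"
  using assms(2)
proof (induction i rule: less_induct)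
  case (less r)
  have zero: "poly (ffact_poly i) (of_nat r) = (0 :: complex)" if "i > r" for i
    unfolding ffact_poly_def poly_prod using that by (intro prod_zero) auto
  have nz: "poly (ffact_poly r) (of_nat r) \<noteq> (0 :: complex)"
    by (auto simp: ffact_poly_def poly_prod)
  have "0 = (\<Sum>i\<le>N. c i * poly (ffact_poly i) (of_nat r))"
    using arg_cong[OF assms(1), of "\<lambda>p. poly p (of_nat r)"] by (simp add: poly_sum)
  also have "\<dots> = (\<Sum>i\<in>{r}. c i * poly (ffact_poly i) (of_nat r))"
  proof (rule sum.mono_neutral_right)
    show "\<forall>i\<in>{..N} - {r}. c i * poly (ffact_poly i) (of_nat r) = 0"
      using less.IH less.prems zero by (auto simp: not_less_iff_gr_or_eq neq_iff)
  qed (use less.prems in auto)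
  finally show ?case using nz by simp
qed

lemma map_poly_coeff_sum:
  "map_poly (\<lambda>p. coeff p j) (\<Sum>i\<in>S. f i) = (\<Sum>i\<in>S. map_poly (\<lambda>p. coeff p j) (f i :: complex poly poly))"
  by (rule poly_eqI) (simp add: coeff_map_poly coeff_sum)

lemma coeff_ffact_poly_const: "coeff (ffact_poly i :: complex poly poly) s = [:coeff (ffact_poly i) s:]"
proof (induction i arbitrary: s)
  case (Suc i)
  then show ?case by (cases s) (simp_all add: ffact_poly_Suc of_nat_poly)
qed (simp add: ffact_poly_def one_pCons coeff_pCons split: nat.splits)

lemma map_poly_lookup_natural:
  assumes "\<And>k. degree (Poly_Mapping.lookup \<pi> k) \<le> N"
  shows "map_poly (\<lambda>p. coeff p j) (Poly_Mapping.lookup (natural \<pi>) d) =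
    (\<Sum>i\<le>N. Polynomial.smult (coeff (coeff (Poly_Mapping.lookup \<pi> (d + int i)) i) j) (ffact_poly i))"
  unfolding lookup_natural[OF assms] map_poly_coeff_sum
  by (intro sum.cong refl poly_eqI) (simp add: coeff_map_poly coeff_ffact_poly_const mult.commute)

text \<open>The falling factorials are independent, so passing to the symbol loses no power of y;
  this lets \<open>degy\<close> be read off the symbol.\<close>

lemma natural_ycoeff_eq_0_iff:
  "(\<forall>d. map_poly (\<lambda>p. coeff p j) (Poly_Mapping.lookup (natural \<pi>) d) = 0) \<longleftrightarrow>
   (\<forall>k i. coeff (coeff (Poly_Mapping.lookup \<pi> k) i) j = 0)"
proof -
  obtain N where N: "\<And>k. degree (Poly_Mapping.lookup \<pi> k) \<le> N" using degree_lookup_bounded by blast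
  show ?thesis
  proof
    assume *: "\<forall>d. map_poly (\<lambda>p. coeff p j) (Poly_Mapping.lookup (natural \<pi>) d) = 0"
    show "\<forall>k i. coeff (coeff (Poly_Mapping.lookup \<pi> k) i) j = 0"
    proof (intro allI)
      fix k i
      show "coeff (coeff (Poly_Mapping.lookup \<pi> k) i) j = 0"
      proof (cases "i \<le> N")
        case True
        have "(\<Sum>r\<le>N. Polynomial.smult
            (coeff (coeff (Poly_Mapping.lookup \<pi> (k - int i + int r)) r) j) (ffact_poly r)) = 0"
          using * unfolding map_poly_lookup_natural[OF N] by blast
        from ffact_poly_independent[OF this True]
        show ?thesis by simp
      next
        case False
        then show ?thesis using N[of k] by (simp add: coeff_eq_0)
      qed
    qed
  qed (simp add: map_poly_lookup_natural[OF N])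
qed

lemma finite_ydegrees: "finite {j. \<exists>k i. coeff (coeff (Poly_Mapping.lookup \<pi> k) i) j \<noteq> 0}"
  for \<pi> :: "int \<Rightarrow>\<^sub>0 complex poly poly"
proof (rule finite_subset)
  show "{j. \<exists>k i. coeff (coeff (Poly_Mapping.lookup \<pi> k) i) j \<noteq> 0} \<subseteq>
    (\<Union>k\<in>Poly_Mapping.keys \<pi>. \<Union>i\<le>degree (Poly_Mapping.lookup \<pi> k).
      {..degree (coeff (Poly_Mapping.lookup \<pi> k) i)})"
  proof (rule subsetI, elim CollectE exE)
    fix j k i assume *: "coeff (coeff (Poly_Mapping.lookup \<pi> k) i) j \<noteq> 0"
    have "j \<le> degree (coeff (Poly_Mapping.lookup \<pi> k) i)" using * by (rule le_degree)
    moreover have "i \<le> degree (Poly_Mapping.lookup \<pi> k)" using * by (intro le_degree) auto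
    moreover have "k \<in> Poly_Mapping.keys \<pi>" using * by (auto simp: in_keys_iff)
    ultimately show "j \<in> (\<Union>k\<in>Poly_Mapping.keys \<pi>. \<Union>i\<le>degree (Poly_Mapping.lookup \<pi> k).
      {..degree (coeff (Poly_Mapping.lookup \<pi> k) i)})" by blast
  qed
qed auto

lemma degy_le_iff:
  "degy \<pi> \<le> n \<longleftrightarrow> (\<forall>j>n. \<forall>d. map_poly (\<lambda>p. coeff p j) (Poly_Mapping.lookup (natural \<pi>) d) = 0)"
proof -
  have "degy \<pi> \<le> n \<longleftrightarrow>
      (\<forall>j\<in>insert 0 {j. \<exists>k i. coeff (coeff (Poly_Mapping.lookup \<pi> k) i) j \<noteq> 0}. j \<le> n)"
    unfolding degy_def by (rule Max_le_iff) (use finite_ydegrees[of \<pi>] in auto)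
  also have "\<dots> \<longleftrightarrow> (\<forall>j>n. \<forall>k i. coeff (coeff (Poly_Mapping.lookup \<pi> k) i) j = 0)"
    by (auto simp: not_le; meson not_le)
  finally show ?thesis by (simp only: natural_ycoeff_eq_0_iff)
qed

section \<open>Preservation of W and the forced zeros of the symbol\<close>

lemma Wspace_support:
  assumes "w \<in> Wspace lam" "n \<notin> Jset lam"
  shows "fls_nth w n = 0"
proof -
  interpret W: Modules.module "\<lambda>c f. fls_const c * f :: complex fls"
    by unfold_locales (simp_all add: algebra_simps flip: fls_plus_const)
  have "w \<in> W.span (fls_X_intpow ` Jset lam)" using assms(1) by (simp add: Wspace_def)
  then show ?thesis
  proof (induction rule: W.span_induct_alt)
    case (step c x y)
    then show ?case using assms(2) by (auto split: if_splits)
  qed simp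
qed

lemma X_intpow_in_Wspace:
  assumes "m \<in> Jset lam"
  shows "fls_X_intpow m \<in> Wspace lam"
proof -
  interpret W: Modules.module "\<lambda>c f. fls_const c * f :: complex fls"
    by unfold_locales (simp_all add: algebra_simps flip: fls_plus_const)
  show ?thesis unfolding Wspace_def using assms by (intro W.span_base imageI)
qed

text \<open>\<open>natural\<close> takes operators with coefficients involving y; for a single
  y-coefficient the symbol is written out directly.\<close>

lemma fls_nth_diffop_X_intpow:
  fixes \<pi> :: "int \<Rightarrow>\<^sub>0 complex poly"
  assumes "\<And>k. degree (Poly_Mapping.lookup \<pi> k) \<le> N"
  shows "fls_nth (diffop_apply (\<lambda>c. c) \<pi> (fls_X_intpow m)) n =
    (\<Sum>i\<le>N. coeff (Poly_Mapping.lookup \<pi> (n - m + int i)) i * poly (ffact_poly i) (of_int m))"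
proof -
  have "fls_nth (diffop_apply (\<lambda>c. c) \<pi> (fls_X_intpow m)) n =
    (\<Sum>k\<in>Poly_Mapping.keys \<pi>. \<Sum>i\<le>degree (Poly_Mapping.lookup \<pi> k).
      if k - int i = n - m then coeff (Poly_Mapping.lookup \<pi> k) i * poly (ffact_poly i) (of_int m) else 0)"
    unfolding diffop_apply_def fls_nth_sum fls_nth_const_intpow_mult fls_nth_higher_deriv_X_intpow
    by (intro sum.cong refl) auto
  also have "\<dots> = (\<Sum>i\<le>N. coeff (Poly_Mapping.lookup \<pi> (n - m + int i)) i * poly (ffact_poly i) (of_int m))"
    by (rule sum_diff_eq_index) (use assms in auto)
  finally show ?thesis .
qed

text \<open>The coefficient of z^n in the image of z^m must vanish when the image lies in W. These
  zeros are the roots of \<open>gam\<close>.\<close>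

lemma Aalg_y_vanish:
  assumes "\<pi> \<in> Aalg_y lam" "m \<in> Jset lam" "n \<notin> Jset lam"
  shows "poly (map_poly (\<lambda>p. coeff p j) (Poly_Mapping.lookup (natural \<pi>) (n - m))) (of_int m) = 0"
proof -
  obtain N where N: "\<And>k. degree (Poly_Mapping.lookup \<pi> k) \<le> N" using degree_lookup_bounded by blast
  have lookup: "Poly_Mapping.lookup (ycoeff j \<pi>) k = map_poly (\<lambda>p. coeff p j) (Poly_Mapping.lookup \<pi> k)" for k
    by (simp add: ycoeff_def Poly_Mapping.map.rep_eq when_def)
  have N': "degree (Poly_Mapping.lookup (ycoeff j \<pi>) k) \<le> N" for k
    unfolding lookup by (rule degree_le) (use N[of k] in \<open>auto simp: coeff_map_poly coeff_eq_0\<close>)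
  have "diffop_apply (\<lambda>c. c) (ycoeff j \<pi>) (fls_X_intpow m) \<in> Wspace lam"
    using assms(1,2) X_intpow_in_Wspace by (auto simp: Aalg_y_def Aalg_def)
  then have "fls_nth (diffop_apply (\<lambda>c. c) (ycoeff j \<pi>) (fls_X_intpow m)) n = 0"
    using assms(3) by (rule Wspace_support)
  then show ?thesis
    unfolding fls_nth_diffop_X_intpow[OF N'] map_poly_lookup_natural[OF N]
    by (simp add: lookup coeff_map_poly poly_sum)
qed

lemma prod_linear_dvd:
  assumes "finite S" "\<And>i. i \<in> S \<Longrightarrow> poly p (of_int i) = 0"
  shows "(\<Prod>i\<in>S. [:- of_int i, 1:]) dvd (p :: complex poly)"
  using assms
proof (induction S arbitrary: p)
  case (insert i S)
  have "[:- of_int i, 1:] dvd p" using insert.prems[of i] by (simp add: poly_eq_0_iff_dvd)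
  then obtain r where r: "p = [:- of_int i, 1:] * r" by (rule dvdE)
  have "poly r (of_int s) = 0" if "s \<in> S" for s
  proof -
    have "s \<noteq> i" using that insert by auto
    then show ?thesis using insert.prems[of s] that by (auto simp: r)
  qed
  then have "(\<Prod>i\<in>S. [:- of_int i, 1:]) dvd r" by (rule insert.IH)
  then show ?case
    unfolding r prod.insert[OF insert.hyps(1,2)] by (rule mult_dvd_mono[OF dvd_refl])
qed simp

section \<open>Evaluation of Laurent polynomials at numbers\<close>

lemma eval3_superset:
  "finite K \<Longrightarrow> Poly_Mapping.keys P \<subseteq> K \<Longrightarrow>
     eval3 P m y z = (\<Sum>k\<in>K. poly (poly (Poly_Mapping.lookup P k) [:m:]) y * z powi k)"
  unfolding eval3_def by (rule sum.mono_neutral_left) (auto simp: in_keys_iff)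

lemma eval3_add: "eval3 (P + Q) m y z = eval3 P m y z + eval3 Q m y z"
  using Poly_Mapping.keys_add[of P Q]
  by (simp add: eval3_superset[of "Poly_Mapping.keys P \<union> Poly_Mapping.keys Q"] lookup_add
      sum.distrib algebra_simps)

lemma eval3_sum: "eval3 (\<Sum>i\<in>S. f i) m y z = (\<Sum>i\<in>S. eval3 (f i) m y z)"
  by (induction S rule: infinite_finite_induct) (simp_all add: eval3_add, simp_all add: eval3_def)

lemma eval3_single: "eval3 (Poly_Mapping.single k p) m y z = poly (poly p [:m:]) y * z powi k"
  by (subst eval3_superset[of "{k}"]) auto

lemma poly_map_const: "poly (map_poly (\<lambda>c. [:c:]) p) [:x:] = [:poly p x:]"
  by (induction p) (auto simp: map_poly_pCons mult.commute)

section \<open>The difference operator\<close>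

context partition begin

text \<open>(m+l)! is the product of m - i over -l <= i < m. For m at least the largest entry, all
  of m_1, ..., m_l lie in this range, and \<open>mprod\<close> removes their factors, leaving those
  from J.\<close>

lemma psi_coeff_mult_prod:
  assumes m: "int (lam 1) \<le> m"
  shows "psi_coeff m * (\<Prod>i\<in>{i \<in> Jset lam. i < m}. of_int m - of_int i) = 1"
proof -
  define f :: "int \<Rightarrow> complex" where "f i = of_int m - of_int i" for i
  define l where "l = int (plen lam)"
  have J: "m \<in> Jset lam" using Jset_large[OF m] .
  define n where "n = nat (m + l)"
  have n: "int n = m + l" using J by (auto simp: n_def l_def Jset_iff)
  have inj: "inj_on (mpart lam) {1..plen lam}"
    by (rule inj_onI) (metis atLeastAtMost_iff linorder_neqE_nat mpart_less order_less_irrefl)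
  have "mprod m = prod f (mpart lam ` {1..plen lam})"
    unfolding prod.reindex[OF inj] by (simp add: mprod_def f_def)
  moreover have "fact n = prod f {-l..<m}"
  proof -
    have "(fact n :: complex) = (\<Prod>j=1..n. of_nat j)" by (simp add: fact_prod)
    also have "\<dots> = prod f {-l..<m}"
      by (rule prod.reindex_bij_witness[of _ "\<lambda>i. nat (m - i)" "\<lambda>j. m - int j"])
        (use n in \<open>auto simp: f_def\<close>)
    finally show ?thesis .
  qed
  moreover have "prod f {-l..<m} = prod f {i \<in> Jset lam. i < m} * prod f (mpart lam ` {1..plen lam})"
  proof -
    have "{-l..<m} = {i \<in> Jset lam. i < m} \<union> mpart lam ` {1..plen lam}"
      using Mset_less m mpart_gt by (fastforce simp: Jset_iff l_def Mset_eq)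
    moreover have "finite {i \<in> Jset lam. i < m}"
      by (rule finite_subset[of _ "{-l..<m}"]) (auto simp: Jset_iff l_def)
    moreover have "{i \<in> Jset lam. i < m} \<inter> mpart lam ` {1..plen lam} = {}"
      by (auto simp: Jset_iff)
    ultimately show ?thesis by (metis finite_atLeastAtMost finite_imageI prod.union_disjoint)
  qed
  ultimately have "fact n = mprod m * prod f {i \<in> Jset lam. i < m}" by (simp only: mult_ac)
  moreover have "psi_coeff m = mprod m / fact n" by (simp add: psi_coeff_def n_def l_def)
  ultimately have "psi_coeff m * prod f {i \<in> Jset lam. i < m} = fact n / fact n"
    by (metis times_divide_eq_left)
  then show ?thesis by (simp add: f_def)
qed

lemma Gset_iff: "i \<in> Gset lam k \<longleftrightarrow> i \<in> Jset lam \<and> i - k \<notin> Jset lam"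
  unfolding Gset_def Jset_def by (force simp: image_iff)

lemma not_Jset_less: "m \<notin> Jset lam \<Longrightarrow> m < int (lam 1)"
  using Jset_large not_le by blast

lemma finite_Gset: "finite (Gset lam k)"
proof (rule finite_subset)
  show "Gset lam k \<subseteq> {- int (plen lam)..<int (lam 1) + k}"
    using not_Jset_less by (force simp: Gset_iff Jset_iff)
qed simp

text \<open>By \<open>psi_coeff_mult_prod\<close>, 1/c_m and 1/c_(m+k) are products over J and over
  J shifted by -k, cut off below m. The common factors cancel; the two set differences are
  \<open>Gset lam (- k)\<close> and the shifted \<open>Gset lam k\<close>, which lie entirely below
  the cutoff because m is large.\<close>

lemma gam_psi_coeff:
  assumes m: "int (lam 1) \<le> m" "int (lam 1) \<le> m + k"
  shows "poly (gam lam (- k)) (of_int m) * psi_coeff m =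
    poly (gam lam k) (of_int (m + k)) * psi_coeff (m + k)"
proof -
  define f :: "int \<Rightarrow> complex" where "f i = of_int m - of_int i" for i
  define U where "U = {i \<in> Jset lam. i < m}"
  define U' where "U' = {i. i + k \<in> Jset lam \<and> i < m}"
  have fin: "finite U" "finite U'"
    by (rule finite_subset[of _ "{- int (plen lam)..<m}"], auto simp: U_def Jset_iff)
      (rule finite_subset[of _ "{- int (plen lam) - k..<m}"], auto simp: U'_def Jset_iff)
  have fnz: "prod f (U \<inter> U') \<noteq> 0"
    using fin by (auto simp: f_def U_def)
  have U: "psi_coeff m * prod f U = 1"
    using psi_coeff_mult_prod[OF m(1)] by (simp add: f_def U_def)
  have U': "psi_coeff (m + k) * prod f U' = 1"
  proof -
    have "(\<Prod>i\<in>{i \<in> Jset lam. i < m + k}. of_int (m + k) - of_int i) = prod f U'"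
      by (rule prod.reindex_bij_witness[of _ "\<lambda>i. i + k" "\<lambda>i. i - k"])
        (auto simp: f_def U'_def)
    then show ?thesis using psi_coeff_mult_prod[OF m(2)] by simp
  qed
  have G: "poly (gam lam (- k)) (of_int m) = prod f (U - U')"
  proof -
    have "Gset lam (- k) = U - U'"
      using not_Jset_less m by (force simp: Gset_iff U_def U'_def)
    then show ?thesis by (simp add: gam_def poly_prod f_def)
  qed
  have G': "poly (gam lam k) (of_int (m + k)) = prod f (U' - U)"
  proof -
    have "poly (gam lam k) (of_int (m + k)) = (\<Prod>i\<in>Gset lam k. of_int (m + k) - of_int i)"
      by (simp add: gam_def poly_prod)
    also have "\<dots> = prod f (U' - U)"
      by (rule prod.reindex_bij_witness[of _ "\<lambda>i. i + k" "\<lambda>i. i - k"])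
        (use not_Jset_less m in \<open>force simp: Gset_iff U_def U'_def f_def\<close>)+
    finally show ?thesis .
  qed
  have "prod f U = prod f (U \<inter> U') * prod f (U - U')"
    by (rule prod.Int_Diff[OF fin(1)])
  moreover have "prod f U' = prod f (U \<inter> U') * prod f (U' - U)"
    using prod.Int_Diff[OF fin(2), of f U] by (simp only: Int_commute)
  ultimately have "prod f (U \<inter> U') * (prod f (U - U') * psi_coeff m) =
      prod f (U \<inter> U') * (prod f (U' - U) * psi_coeff (m + k))"
    using U U' by (simp add: mult_ac)
  then show ?thesis unfolding G G' using fnz by simp
qed

end

section \<open>Homogeneity and symmetry of the symbol coefficients\<close>

lemma nat_coeff_eq_ycoeff:
  "int q - k = 2 * int j \<Longrightarrow>
     nat_coeff q \<pi> k = map_poly (\<lambda>p. coeff p j) (Poly_Mapping.lookup (natural \<pi>) (- k))"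
  by (auto simp: nat_coeff_def)

lemma nat_coeff_eq_0: "(\<nexists>j. int q - k = 2 * int j) \<Longrightarrow> nat_coeff q \<pi> k = 0"
  by (auto simp: nat_coeff_def elim!: evenE dest!: spec[of _ "nat ((int q - k) div 2)"])

locale bispectral = partition +
  fixes q :: nat and \<sigma> :: "complex poly poly" and \<pi> :: "int \<Rightarrow>\<^sub>0 complex poly poly"
  assumes homogeneous: "weighted_homogeneous q \<sigma>" and sharp: "is_sharp lam \<sigma> \<pi>"
begin

abbreviation N :: "int \<Rightarrow> complex poly poly" where
  "N k \<equiv> Poly_Mapping.lookup (natural \<pi>) (- k)"

abbreviation pi_q :: "int \<Rightarrow> complex poly" where
  "pi_q k \<equiv> nat_coeff q \<pi> k"

lemma homog_sigma: "homog (int q) \<sigma>"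
  using homogeneous by (force simp: weighted_homogeneous_def homog_def)

text \<open>For large n a nonzero value would be a recurrence coefficient of the wrong weight. Thus
  the homogeneity of \<sigma> passes to \<pi>.\<close>

lemma ycoeff_N_eq_0:
  assumes "int q - k \<noteq> 2 * int j"
  shows "map_poly (\<lambda>p. coeff p j) (N k) = 0"
proof (rule poly_eq_0_of_large)
  fix n assume n: "max (int (lam 1)) (int (lam 1) + k) \<le> n"
  define m where "m = n - k"
  have J: "m \<in> Jset lam" "n \<in> Jset lam" using n by (auto simp: m_def intro: Jset_large)
  show "poly (map_poly (\<lambda>p. coeff p j) (N k)) (of_int n) = 0"
  proof (rule ccontr)
    assume "\<not> ?thesis"
    then have nz: "coeff (rec_coeff \<pi> m n) j \<noteq> 0"
      unfolding rec_coeff_eq[OF J(2)] coeff_smult coeff_poly_of_int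
      using psi_coeff_nonzero J by (simp add: m_def)
    then have "n \<in> rec_set \<pi> m" by (auto simp: rec_coeff_def split: if_splits)
    then have "int q + m = n + 2 * int j"
      using recurrence_homogeneous[OF finite_rec_set rec_set_subset homog_sigma J(1) sharp_recurrence[OF sharp J(1)]] nz
      by blast
    then show False using assms by (simp add: m_def)
  qed
qed

lemma ycoeff_N: "map_poly (\<lambda>p. coeff p j) (N k) = (if int q - k = 2 * int j then pi_q k else 0)"
  using ycoeff_N_eq_0 by (simp add: nat_coeff_eq_ycoeff)

lemma N_eq: "N k = Polynomial.smult (Polynomial.monom 1 (nat ((int q - k) div 2)))
    (map_poly (\<lambda>c. [:c:]) (pi_q k))"
proof (intro poly_eqI)
  fix i j
  have "coeff (coeff (N k) i) j = coeff (map_poly (\<lambda>p. coeff p j) (N k)) i"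
    by (simp add: coeff_map_poly)
  also have "\<dots> = (if int q - k = 2 * int j then coeff (pi_q k) i else 0)"
    by (simp add: ycoeff_N)
  \<comment> \<open>\<open>nat\<close> and \<open>div\<close> distort the exponent when q - k is odd
    or negative, but then \<open>pi_q k\<close> is zero.\<close>
  also have "\<dots> = (if nat ((int q - k) div 2) = j then coeff (pi_q k) i else 0)"
  proof (cases "\<exists>j. int q - k = 2 * int j")
    case True
    then show ?thesis by auto
  qed (simp add: nat_coeff_eq_0)
  finally show "coeff (coeff (N k) i) j = coeff (coeff (Polynomial.smult (Polynomial.monom 1
      (nat ((int q - k) div 2))) (map_poly (\<lambda>c. [:c:]) (pi_q k))) i) j"
    by (simp add: coeff_map_poly mult.commute[of "Polynomial.monom _ _"] smult_monom)
qed

lemma poly_N: "poly (N k) (of_int n) = Polynomial.monom (poly (pi_q k) (of_int n)) (nat ((int q - k) div 2))"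
proof -
  have "(of_int n :: complex poly) = [:of_int n:]" by (rule of_int_poly)
  then show ?thesis
    by (simp add: N_eq poly_map_const mult.commute[of "Polynomial.monom _ _"] smult_monom)
qed

lemma rec_coeff_eq_monom:
  assumes "m + k \<in> Jset lam"
  shows "rec_coeff \<pi> m (m + k) = Polynomial.monom
    (psi_coeff (m + k) / psi_coeff m * poly (pi_q k) (of_int (m + k))) (nat ((int q - k) div 2))"
  using rec_coeff_eq[OF assms, of \<pi> m] poly_N[of k "m + k"] by (simp add: smult_monom)

text \<open>This is \<open>recurrence_symmetric\<close> for the pair m, m+k. Since
  \<open>mprod m\<close> is c_m times a factorial, the factorials cancel against those of the norms,
  and the difference k of the two Hermite indices leaves (-2)^(-k).\<close>

lemma pi_q_symmetric:
  assumes m: "m \<in> Jset lam" and n: "m + k \<in> Jset lam"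
  shows "psi_coeff (m + k) * poly (pi_q k) (of_int (m + k)) =
    psi_coeff m * ((-2) powi (- k) * poly (pi_q (- k)) (of_int m))"
proof -
  define e f where "e = nat (m + k + int (plen lam))" and "f = nat (m + int (plen lam))"
  have ef: "int e = int f + k" using m n by (auto simp: e_def f_def Jset_iff)
  define a b where "a = poly (pi_q k) (of_int (m + k))" and "b = poly (pi_q (- k)) (of_int m)"
  have c: "psi_coeff m \<noteq> 0" "psi_coeff (m + k) \<noteq> 0" using psi_coeff_nonzero m n by auto
  have mprod: "mprod m = psi_coeff m * fact f" "mprod (m + k) = psi_coeff (m + k) * fact e"
    by (simp_all add: psi_coeff_def e_def f_def)
  have rec: "rec_coeff \<pi> m (m + k) = Polynomial.monom (psi_coeff (m + k) / psi_coeff m * a) (nat ((int q - k) div 2))"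
    "rec_coeff \<pi> (m + k) m = Polynomial.monom (psi_coeff m / psi_coeff (m + k) * b) (nat ((int q + k) div 2))"
    using rec_coeff_eq_monom[OF n] rec_coeff_eq_monom[of "m + k" "- k"] m by (simp_all add: a_def b_def)
  have "Polynomial.smult (mprod m) (rec_coeff \<pi> m (m + k)) * (- 2 * [:0, 1:]) ^ e * fact e
      = Polynomial.smult (mprod (m + k)) (rec_coeff \<pi> (m + k) m) * (- 2 * [:0, 1:]) ^ f * fact f"
    unfolding e_def f_def
  proof (rule recurrence_symmetric[where \<sigma> = \<sigma> and S = "rec_set \<pi>"])
    show "rec_coeff \<pi> m n = 0" if "n \<notin> rec_set \<pi> m" for m n
      using that by (simp add: rec_coeff_def)
  qed (use m n sharp_recurrence[OF sharp] finite_rec_set rec_set_subset in auto)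
  \<comment> \<open>Setting y = 1 discards the powers of y and leaves a scalar identity.\<close>
  from arg_cong[OF this, of "\<lambda>p. poly p 1"]
  have "mprod m * (psi_coeff (m + k) / psi_coeff m * a) * (- 2) ^ e * fact e =
      mprod (m + k) * (psi_coeff m / psi_coeff (m + k) * b) * (- 2) ^ f * fact f"
    by (simp add: rec poly_monom fact_poly_const mult_ac)
  then have "fact e * fact f * (psi_coeff (m + k) * a * (- 2) ^ e) = fact e * fact f * (psi_coeff m * b * (- 2) ^ f)"
    unfolding mprod using c by (simp add: field_simps)
  then have "psi_coeff (m + k) * a * (- 2) ^ e = psi_coeff m * b * (- 2) ^ f" by simp
  moreover have "(- 2) ^ f = (- 2) ^ e * ((- 2) powi (- k) :: complex)"
  proof -
    have "(- 2) ^ f = ((- 2) powi (int e + - k) :: complex)" using ef by simp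
    then show ?thesis by (subst (asm) power_int_add) auto
  qed
  ultimately have "(- 2) ^ e * (psi_coeff (m + k) * a) = (- 2) ^ e * (psi_coeff m * ((- 2) powi (- k) * b))"
    by (simp add: mult_ac)
  then show ?thesis by (simp add: a_def b_def)
qed

lemma rec_coeff_eq_monom':
  assumes m: "m \<in> Jset lam" and n: "m + k \<in> Jset lam"
  shows "rec_coeff \<pi> m (m + k) = Polynomial.monom
    ((-2) powi (- k) * poly (pi_q (- k)) (of_int m)) (nat ((int q - k) div 2))"
  using pi_q_symmetric[OF m n] psi_coeff_nonzero[OF m] unfolding rec_coeff_eq_monom[OF n]
  by (simp add: field_simps)

lemma pi_q_uminus_eq_0:
  assumes "pi_q k = 0"
  shows "pi_q (- k) = 0"
proof (rule poly_eq_0_of_large)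
  fix m assume m: "max (int (lam 1)) (int (lam 1) - k) \<le> m"
  then have J: "m \<in> Jset lam" "m + k \<in> Jset lam" by (auto intro: Jset_large)
  then show "poly (pi_q (- k)) (of_int m) = 0"
    using pi_q_symmetric[OF J] psi_coeff_nonzero[OF J(1)] assms by simp
qed

text \<open>\<open>nat_coeff\<close> is zero for k > q by definition; the symmetry reflects this to
  k < -q. This is the bound on the y-degree.\<close>

lemma pi_q_nonzero:
  assumes "pi_q k \<noteq> 0"
  obtains j where "j \<le> q" "k = int q - 2 * int j"
proof -
  have "pi_q (- k) \<noteq> 0" using assms pi_q_uminus_eq_0[of "- k"] by auto
  then have "- k \<le> int q" by (auto simp: nat_coeff_def split: if_splits)
  moreover obtain j where "int q - k = 2 * int j" using assms nat_coeff_eq_0 by blast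
  ultimately show ?thesis using that[of j] by auto
qed

lemma degy_le: "degy \<pi> \<le> q"
  unfolding degy_le_iff
proof (intro allI impI)
  fix j d assume "q < j"
  show "map_poly (\<lambda>p. coeff p j) (Poly_Mapping.lookup (natural \<pi>) d) = 0"
  proof (rule ccontr)
    assume "\<not> ?thesis"
    then have "map_poly (\<lambda>p. coeff p j) (N (- d)) \<noteq> 0" by simp
    then have *: "int q + d = 2 * int j" "pi_q (- d) \<noteq> 0"
      using ycoeff_N[of j "- d"] by (auto split: if_splits)
    obtain j' where "j' \<le> q" "- d = int q - 2 * int j'" using pi_q_nonzero[OF *(2)] by blast
    then show False using * \<open>q < j\<close> by simp
  qed
qed

lemma pi_q_eq_0_degy: "degy \<pi> < j \<Longrightarrow> pi_q (int q - 2 * int j) = 0"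
  using degy_le_iff[of \<pi> "degy \<pi>"] nat_coeff_eq_ycoeff[of q "int q - 2 * int j" j \<pi>] by simp

lemma pi_q_vanish:
  assumes "m \<in> Jset lam" "m - k \<notin> Jset lam"
  shows "poly (pi_q k) (of_int m) = 0"
proof (cases "\<exists>j. int q - k = 2 * int j")
  case True
  then obtain j where j: "int q - k = 2 * int j" ..
  have "\<pi> \<in> Aalg_y lam" using sharp by (simp add: is_sharp_def)
  from Aalg_y_vanish[OF this assms, of j] show ?thesis
    by (simp add: nat_coeff_eq_ycoeff[OF j])
qed (simp add: nat_coeff_eq_0)

lemma gam_mult_alpha: "gam lam k * alpha lam q \<pi> k = pi_q k"
proof -
  have "gam lam k dvd pi_q k"
    unfolding gam_def by (rule prod_linear_dvd[OF finite_Gset]) (simp add: Gset_iff pi_q_vanish)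
  then show ?thesis by (simp add: alpha_def)
qed

text \<open>Identifies the coefficients of \<open>Theta\<close>. At large m, multiplying by
  \<gamma>_k(m+k) c_(m+k) completes \<alpha> to \<open>pi_q k\<close>; the symmetry replaces it by
  \<open>pi_q (- k)\<close>, and \<open>gam_psi_coeff\<close> removes the factor again.\<close>

lemma gam_mult_alpha_shift:
  "gam lam (- k) * pcompose (alpha lam q \<pi> k) [:of_int k, 1:] = Polynomial.smult ((-2) powi (- k)) (pi_q (- k))"
proof (rule poly_eq_of_large)
  fix m assume "max (int (lam 1)) (int (lam 1) - k) \<le> m"
  then have m: "int (lam 1) \<le> m" "int (lam 1) \<le> m + k" by auto
  then have J: "m \<in> Jset lam" "m + k \<in> Jset lam" by (auto intro: Jset_large)
  let ?x = "of_int m :: complex" and ?g = "poly (gam lam k) (of_int (m + k))"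
  \<comment> \<open>A root m+k of \<open>gam lam k\<close> would mean that m is not in J.\<close>
  have "?g \<noteq> 0"
  proof
    assume "?g = 0"
    then obtain i where "i \<in> Gset lam k" "m + k = i"
      using finite_Gset[of k] by (auto simp: gam_def poly_prod simp flip: of_int_add)
    then show False using J by (auto simp: Gset_iff)
  qed
  have "?g * psi_coeff (m + k) * (poly (gam lam (- k)) ?x * poly (alpha lam q \<pi> k) (of_int (m + k)))
      = poly (gam lam (- k)) ?x * (psi_coeff (m + k) * poly (pi_q k) (of_int (m + k)))"
    by (simp add: gam_mult_alpha[symmetric] mult_ac)
  also have "\<dots> = (poly (gam lam (- k)) ?x * psi_coeff m) * ((-2) powi (- k) * poly (pi_q (- k)) ?x)"
    unfolding pi_q_symmetric[OF J] by (simp only: mult_ac)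
  also have "\<dots> = ?g * psi_coeff (m + k) * ((-2) powi (- k) * poly (pi_q (- k)) ?x)"
    unfolding gam_psi_coeff[OF m] ..
  finally have "poly (gam lam (- k)) ?x * poly (alpha lam q \<pi> k) (of_int (m + k)) =
      (-2) powi (- k) * poly (pi_q (- k)) ?x"
    using \<open>?g \<noteq> 0\<close> psi_coeff_nonzero[OF J(2)] by simp
  then show "poly (gam lam (- k) * pcompose (alpha lam q \<pi> k) [:of_int k, 1:]) ?x =
      poly (Polynomial.smult ((-2) powi (- k)) (pi_q (- k))) ?x"
    by (simp add: poly_pcompose add.commute)
qed

lemma eval3_natural:
  "eval3 (natural \<pi>) m w z = (\<Sum>j\<le>q. w ^ j * poly (pi_q (int q - 2 * int j)) m * z powi (2 * int j - int q))"
proof -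
  define h where "h j = 2 * int j - int q" for j
  have inj: "inj_on h {..q}" by (rule inj_onI) (simp add: h_def)
  have "Poly_Mapping.keys (natural \<pi>) \<subseteq> h ` {..q}"
  proof
    fix d assume "d \<in> Poly_Mapping.keys (natural \<pi>)"
    then have "N (- d) \<noteq> 0" by (simp add: in_keys_iff)
    then have "pi_q (- d) \<noteq> 0" unfolding N_eq[of "- d"] by auto
    then obtain j where "j \<le> q" "- d = int q - 2 * int j" using pi_q_nonzero by blast
    then show "d \<in> h ` {..q}" by (intro image_eqI[of _ _ j]) (auto simp: h_def)
  qed
  then have "eval3 (natural \<pi>) m w z =
      (\<Sum>d\<in>h ` {..q}. poly (poly (Poly_Mapping.lookup (natural \<pi>) d) [:m:]) w * z powi d)"
    by (intro eval3_superset) auto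
  also have "\<dots> = (\<Sum>j\<le>q. poly (poly (N (- h j)) [:m:]) w * z powi h j)"
    by (simp add: sum.reindex[OF inj])
  also have "\<dots> = (\<Sum>j\<le>q. w ^ j * poly (pi_q (int q - 2 * int j)) m * z powi (2 * int j - int q))"
    unfolding N_eq by (intro sum.cong) (simp_all add: h_def poly_map_const poly_monom mult_ac)
  finally show ?thesis .
qed

lemma eval3_Theta:
  "eval3 (Theta lam q \<pi>) m y z = (\<Sum>j\<le>q. y ^ j * ((-2) powi (2 * int j - int q) *
     poly (pi_q (2 * int j - int q)) m) * z powi (int q - 2 * int j))"
proof -
  have "eval3 (Theta lam q \<pi>) m y z = (\<Sum>j\<le>degy \<pi>. y ^ j * ((-2) powi (2 * int j - int q) *
     poly (pi_q (2 * int j - int q)) m) * z powi (int q - 2 * int j))"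
    unfolding Theta_def Let_def eval3_sum eval3_single gam_mult_alpha_shift poly_smult poly_map_const
    by (intro sum.cong) (simp_all add: poly_map_const poly_monom mult_ac)
  also have "\<dots> = (\<Sum>j\<le>q. y ^ j * ((-2) powi (2 * int j - int q) *
     poly (pi_q (2 * int j - int q)) m) * z powi (int q - 2 * int j))"
  proof (rule sum.mono_neutral_left)
    show "\<forall>j\<in>{..q} - {..degy \<pi>}. y ^ j * ((-2) powi (2 * int j - int q) *
     poly (pi_q (2 * int j - int q)) m) * z powi (int q - 2 * int j) = 0"
      using pi_q_uminus_eq_0[OF pi_q_eq_0_degy] by auto
  qed (use degy_le in auto)
  finally show ?thesis .
qed

lemma eval3_Theta_eq:
  assumes y: "y \<noteq> 0"
  shows "eval3 (Theta lam q \<pi>) m y z = (- 2 * y) ^ q * eval3 (natural \<pi>) m (1 / (4 * y)) z"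
proof -
  have "eval3 (natural \<pi>) m (1 / (4 * y)) z = (\<Sum>j\<le>q. (1 / (4 * y)) ^ (q - j) *
      poly (pi_q (2 * int j - int q)) m * z powi (int q - 2 * int j))"
    unfolding eval3_natural
    by (rule sum.reindex_bij_witness[of _ "\<lambda>j. q - j" "\<lambda>j. q - j"])
      (auto simp: of_nat_diff algebra_simps)
  \<comment> \<open>Pairing q - j of the factors -2y with the factors 1/(4y) gives (-1/2)^(q-j); the
    other j factors keep y^j.\<close>
  moreover have "(- 2 * y) ^ q * (1 / (4 * y)) ^ (q - j) = y ^ j * (-2) powi (2 * int j - int q)"
    if "j \<le> q" for j
  proof -
    have "(- 2 * y) ^ q = (- 2 * y) ^ j * (- 2 * y) ^ (q - j)"
      using that by (simp flip: power_add)
    then have "(- 2 * y) ^ q * (1 / (4 * y)) ^ (q - j) = (- 2 * y) ^ j * ((- 2 * y) * (1 / (4 * y))) ^ (q - j)"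
      by (simp only: power_mult_distrib mult_ac)
    also have "(- 2 * y) * (1 / (4 * y)) = inverse (- 2)" using y by simp
    also have "(- 2 * y) ^ j * inverse (- 2) ^ (q - j) = y ^ j * ((- 2) powi (int j) * (- 2) powi (int j - int q))"
      using that unfolding power_mult_distrib[of "- 2" y]
      by (simp add: power_int_def of_nat_diff nat_diff_distrib power_inverse)
    also have "(- 2) powi (int j) * (- 2) powi (int j - int q) = ((- 2) powi (2 * int j - int q) :: complex)"
      by (subst power_int_add[symmetric]) auto
    finally show ?thesis .
  qed
  ultimately show ?thesis
    unfolding eval3_Theta by (simp add: sum_distrib_left mult.assoc[symmetric])
qed

lemma recurrence:
  assumes m: "m \<in> Jset lam"
  shows "to_fract \<sigma> * exc_hermite lam m =
    (\<Sum>k | - int q \<le> k \<and> k \<le> int q \<and> even (int q - k) \<and> m + k \<in> Jset lam.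
      to_fract [:Polynomial.monom ((-2) powi (- k) * poly (pi_q (- k)) (of_int m))
                   (nat ((int q - k) div 2)):] * exc_hermite lam (m + k))"
proof -
  define K where "K = {k. - int q \<le> k \<and> k \<le> int q \<and> even (int q - k) \<and> m + k \<in> Jset lam}"
  define f where "f n = cst (rec_coeff \<pi> m n) * exc_hermite lam n" for n
  have fin: "finite K" by (rule finite_subset[of _ "{- int q..int q}"]) (auto simp: K_def)
  have zero: "rec_coeff \<pi> m n = 0" if "n \<notin> (\<lambda>k. m + k) ` K" "n \<in> Jset lam" for n
  proof (rule ccontr)
    define k where "k = n - m"
    have n: "n = m + k" by (simp add: k_def)
    assume "rec_coeff \<pi> m n \<noteq> 0"
    then have "pi_q k \<noteq> 0" unfolding n using rec_coeff_eq_monom[of m k] that by (auto simp: n)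
    then obtain j where "j \<le> q" "k = int q - 2 * int j" using pi_q_nonzero by blast
    then have "k \<in> K" using that n by (auto simp: K_def)
    then show False using that n by auto
  qed
  have "to_fract \<sigma> * exc_hermite lam m = (\<Sum>n\<in>rec_set \<pi> m. f n)"
    unfolding f_def by (rule sharp_recurrence[OF sharp m])
  \<comment> \<open>The two index sets need not be nested, so the sum passes through their union;
    the added terms have coefficient zero on either side.\<close>
  also have "\<dots> = (\<Sum>n\<in>rec_set \<pi> m \<union> (\<lambda>k. m + k) ` K. f n)"
    by (rule sum.mono_neutral_left) (auto simp: fin finite_rec_set f_def rec_coeff_def)
  also have "\<dots> = (\<Sum>n\<in>(\<lambda>k. m + k) ` K. f n)"
    by (rule sum.mono_neutral_right) (auto simp: fin finite_rec_set f_def intro!: zero dest: subsetD[OF rec_set_subset])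
  also have "\<dots> = (\<Sum>k\<in>K. f (m + k))" by (simp add: sum.reindex)
  also have "\<dots> = (\<Sum>k\<in>K. to_fract [:Polynomial.monom ((-2) powi (- k) * poly (pi_q (- k)) (of_int m))
                   (nat ((int q - k) div 2)):] * exc_hermite lam (m + k))"
    by (intro sum.cong refl) (simp add: f_def K_def rec_coeff_eq_monom'[OF m] cst_def)
  finally show ?thesis by (simp only: K_def)
qed

end

theorem theorem6p7:
  fixes lam :: "nat \<Rightarrow> nat" and q :: nat
    and \<sigma> :: "complex poly poly" and \<pi> :: "int \<Rightarrow>\<^sub>0 complex poly poly"
  assumes "is_partition lam"
    and "critical_degree lam q"
    and "\<sigma> \<in> Rstar lam"
    and "weighted_homogeneous q \<sigma>"
    and "degree \<sigma> = q"
    and "lead_coeff \<sigma> = 1"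
    and "is_sharp lam \<sigma> \<pi>"
  shows "degy \<pi> \<le> q \<and>
    (\<forall>m y z. y \<noteq> 0 \<longrightarrow> z \<noteq> 0 \<longrightarrow>
       eval3 (Theta lam q \<pi>) m y z = (- 2 * y) ^ q * eval3 (natural \<pi>) m (1 / (4 * y)) z) \<and>
    (\<forall>m\<in>Jset lam.
       to_fract \<sigma> * exc_hermite lam m =
         (\<Sum>k | - int q \<le> k \<and> k \<le> int q \<and> even (int q - k) \<and> m + k \<in> Jset lam.
            to_fract [:Polynomial.monom ((-2) powi (- k) * poly (nat_coeff q \<pi> (- k)) (of_int m))
                         (nat ((int q - k) div 2)):] * exc_hermite lam (m + k))) \<and>
    (\<forall>m\<in>Jset lam. \<forall>k. - int q \<le> k \<and> k \<le> int q \<and> even (int q - k) \<and> m + k \<notin> Jset lam \<longrightarrow>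
       poly (nat_coeff q \<pi> (- k)) (of_int m) = 0)"
proof -
  interpret bispectral lam q \<sigma> \<pi>
    using assms by unfold_locales
  \<comment> \<open>The vanishing of the omitted terms is \<open>pi_q_vanish\<close> with -k in
    place of k.\<close>
  show ?thesis
    using degy_le eval3_Theta_eq recurrence pi_q_vanish by auto
qed

end
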